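(* Let $f\in\mathcal{C}^{p,\beta}(\mathbb{R}^n)$ (with constants $L$ and $f_{\rm low}$ as in the context), let $\mathcal{F}\subseteq\mathbb{R}^n$ be closed and nonempty, and let $q\in\{1,\dots,p\}$. Let $$\sigma_{\max}:=\max\left[\sigma_0,\frac{\gamma_3L}{1-\eta_2}\right],\qquad \kappa_p:=\frac{(p+\beta)!}{\eta_1\sigma_{\min}}\max\left\{\varpi^{-(p+\beta)},\left[\frac{L+\sigma_{\max}+\theta}{(p-q+\beta)!}\right]^{\frac{p+\beta}{p-q+\beta}}\right\}.$$ Then, given $\epsilon\in(0,1)$, Algorithm AR$p$ (described in the context) needs at most $$\left\lfloor\kappa_p\,(f(x_0)-f_{\rm low})\,\epsilon^{-\frac{p+\beta}{p-q+\beta}}\right\rfloor+1$$ successful iterations (each involving one evaluation of $f$ and its $p$ first derivatives) and at most $$\left\lfloor\left\lfloor\kappa_p\,(f(x_0)-f_{\rm low})\,\epsilon^{-\frac{p+\beta}{p-q+\beta}}+1\right\rfloor\left(1+\frac{|\log\gamma_1|}{\log\gamma_2}\right)+\frac{1}{\log\gamma_2}\log\left(\frac{\sigma_{\max}}{\sigma_0}\right)\right\rfloor$$ iterations in total to produce an iterate $x_\epsilon\in\mathcal{F}$ such that $\phi_{f,q}^{\delta}(x_\epsilon)\le\epsilon\,\chi_q(\delta)$ for some $\delta\in(0,1]$.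
   Context: Problem: minimize $f(x)$ over $x\in\mathcal{F}$, where $\mathcal{F}\subseteq\mathbb{R}^n$ is closed and nonempty (not necessarily convex or connected). $\|\cdot\|$ is the Euclidean norm; for a symmetric tensor $S$ of order $j$, $S[v]^j$ is $S$ applied to $j$ copies of $v$ and $\|S\|_{[j]}:=\max_{\|v\|=1}|S[v]^j|$. $f\in\mathcal{C}^{p,\beta}(\mathbb{R}^n)$ ($p\ge1$ integer, $\beta\in(0,1]$) means: $f:\mathbb{R}^n\to\mathbb{R}$ is $p$ times continuously differentiable, $f\ge f_{\rm low}$ everywhere for some constant $f_{\rm low}$, and there is $L\ge0$ with $\|\nabla_x^pf(x)-\nabla_x^pf(y)\|_{[p]}\le L\|x-y\|^\beta$ for all $x,y\in\mathbb{R}^n$. The value of $\beta$ is known to the algorithm. Notation: $(k+\beta)!:=\prod_{\ell=1}^k(\beta+\ell)$ for integers $k\ge 0$ (empty product $=1$). $T_j(x,s):=f(x)+\sum_{\ell=1}^j\frac1{\ell!}\nabla_x^\ell f(x)[s]^\ell$. $\chi_q(\delta):=\sum_{\ell=1}^q\delta^\ell/\ell!$. For $x\in\mathcal{F}$, $\delta\in(0,1]$, $$\phi_{f,q}^\delta(x):=f(x)-\min_{x+d\in\mathcal{F},\,\|d\|\le\delta}T_q(x,d)\quad\text{(global minimum)}.$$ A point $x\in\mathcal{F}$ with $\phi_{f,q}^\delta(x)\le\epsilon\chi_q(\delta)$ is called an $(\epsilon,\delta)$-approximate $q$-th-order-necessary minimizer. Algorithm AR$p$. Step 0. Given $x_0\in\mathcal{F}$,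 $\sigma_0>0$, $\epsilon\in(0,1)$ and constants $\varpi\in(0,1]$, $\theta>0$, $\delta_{-1}\in(0,1]$, $\sigma_{\min}\in(0,\sigma_0]$, $0<\eta_1\le\eta_2<1$, $0<\gamma_1<1<\gamma_2<\gamma_3$. Compute $f(x_0)$; set $k=0$. Step 1. Evaluate $\nabla_x^if(x_k)$, $i=1,\dots,q$. If $\phi_{f,q}^{\delta_{k-1}}(x_k)\le\epsilon\chi_q(\delta_{k-1})$, terminate with $x_\epsilon=x_k$. Otherwise compute $\nabla_x^if(x_k)$, $i=q+1,\dots,p$. Step 2. With the model $m_k(s):=T_p(x_k,s)+\frac{\sigma_k}{(p+\beta)!}\|s\|^{p+\beta}$, attempt to compute a step $s_k$ with $x_k+s_k\in\mathcal{F}$ and a radius $\delta_k\in(0,1]$ such that $m_k(s_k)<m_k(0)$ and either (i) $\|s_k\|\ge\varpi\epsilon^{\frac1{p-q+\beta}}$, or (ii) $\phi_{m_k,q}^{\delta_k}(s_k)\le\frac{\theta\|s_k\|^{p-q+\beta}}{(p-q+\beta)!}\chi_q(\delta_k)$, where $\phi_{m_k,q}^{\delta}(s):=\max_{x_k+s+d\in\mathcal{F},\,\|d\|\le\delta}\big(-\sum_{\ell=1}^q\frac1{\ell!}\nabla_s^\ell m_k(s)[d]^\ell\big)$. (Any such pair may be chosen.) If no such pair exists, terminate with $x_\epsilon=x_k$. Step 3. Compute $f(x_k+s_k)$ and $\rho_k=\frac{f(x_k)-f(x_k+s_k)}{T_p(x_k,0)-T_p(x_k,s_k)}$. If $\rho_k\ge\eta_1$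 set $x_{k+1}=x_k+s_k$; otherwise $x_{k+1}=x_k$. Step 4. Choose $\sigma_{k+1}\in[\max(\sigma_{\min},\gamma_1\sigma_k),\sigma_k]$ if $\rho_k\ge\eta_2$; $\sigma_{k+1}\in[\sigma_k,\gamma_2\sigma_k]$ if $\rho_k\in[\eta_1,\eta_2)$; $\sigma_{k+1}\in[\gamma_2\sigma_k,\gamma_3\sigma_k]$ if $\rho_k<\eta_1$. Increment $k$ by one; go to Step 1 if the iteration just completed had $\rho\ge\eta_1$, and to Step 2 otherwise. Iteration $k$ is successful if $\rho_k\ge\eta_1$. Iterations counted are those in which a trial point $x_k+s_k$ is computed and evaluated (the final, terminating pass through Step 1 or Step 2 is not counted). *)

theory Defs
  imports "HOL-Analysis.Analysis"
begin

(* nabla f [v1, ..., vl] x is the derivative tensor of order l of f at x, applied to v1, ..., vl. *)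
primrec nabla :: "('a::real_normed_vector \<Rightarrow> real) \<Rightarrow> 'a list \<Rightarrow> 'a \<Rightarrow> real" where
  "nabla f [] = f"
| "nabla f (v # vs) = (\<lambda>x. frechet_derivative (nabla f vs) (at x) v)"

(* Testing the tensors on every list of directions is enough: in finite dimension the
   tensor-valued map is differentiable (continuous) iff all these evaluations are. *)
definition cont_differentiable :: "nat \<Rightarrow> ('a::euclidean_space \<Rightarrow> real) \<Rightarrow> bool" where
  "cont_differentiable p f \<longleftrightarrow>
     (\<forall>vs x. length vs < p \<longrightarrow> nabla f vs differentiable (at x)) \<and>
     (\<forall>vs. length vs \<le> p \<longrightarrow> continuous_on UNIV (nabla f vs))"

(* A tensor of order j is represented by its values on lists of j vectors.
   The supremum is a maximum, the unit sphere being compact. *)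
definition tensor_norm :: "nat \<Rightarrow> ('a::euclidean_space list \<Rightarrow> real) \<Rightarrow> real" where
  "tensor_norm j S = (SUP v\<in>sphere 0 1. \<bar>S (replicate j v)\<bar>)"

definition holder_class ::
    "nat \<Rightarrow> real \<Rightarrow> ('a::euclidean_space \<Rightarrow> real) \<Rightarrow> real \<Rightarrow> real \<Rightarrow> bool" where
  "holder_class p \<beta> f f_low L \<longleftrightarrow>
     cont_differentiable p f \<and> (\<forall>x. f_low \<le> f x) \<and> 0 \<le> L \<and>
     (\<forall>x y. tensor_norm p (\<lambda>vs. nabla f vs x - nabla f vs y) \<le> L * norm (x - y) powr \<beta>)"

(* (k + \<beta>)! *)
definition gfact :: "nat \<Rightarrow> real \<Rightarrow> real" where
  "gfact k \<beta> = (\<Prod>l=1..k. \<beta> + real l)"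

definition taylor :: "('a::euclidean_space \<Rightarrow> real) \<Rightarrow> nat \<Rightarrow> 'a \<Rightarrow> 'a \<Rightarrow> real" where
  "taylor f j x s = f x + (\<Sum>l=1..j. 1 / fact l * nabla f (replicate l s) x)"

definition chi :: "nat \<Rightarrow> real \<Rightarrow> real" where
  "chi q \<delta> = (\<Sum>l=1..q. \<delta> ^ l / fact l)"

(* For closed F, the infimum here and the supremum in phi_model are attained: the feasible
   displacements form a compact set, containing 0 when the base point is feasible. *)
definition phi_fun ::
    "('a::euclidean_space \<Rightarrow> real) \<Rightarrow> 'a set \<Rightarrow> nat \<Rightarrow> real \<Rightarrow> 'a \<Rightarrow> real" where
  "phi_fun f F q \<delta> x = f x - (INF d\<in>{d. x + d \<in> F \<and> norm d \<le> \<delta>}. taylor f q x d)"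

definition model ::
    "('a::euclidean_space \<Rightarrow> real) \<Rightarrow> nat \<Rightarrow> real \<Rightarrow> 'a \<Rightarrow> real \<Rightarrow> 'a \<Rightarrow> real" where
  "model f p \<beta> x \<sigma> s = taylor f p x s + \<sigma> / gfact p \<beta> * norm s powr (real p + \<beta>)"

(* m is a model around x, a function of the step s *)
definition phi_model ::
    "('a::euclidean_space \<Rightarrow> real) \<Rightarrow> 'a set \<Rightarrow> 'a \<Rightarrow> nat \<Rightarrow> real \<Rightarrow> 'a \<Rightarrow> real" where
  "phi_model m F x q \<delta> s =
     (SUP d\<in>{d. x + s + d \<in> F \<and> norm d \<le> \<delta>}.
        - (\<Sum>l=1..q. 1 / fact l * nabla m (replicate l d) s))"

definition stop_test ::
    "('a::euclidean_space \<Rightarrow> real) \<Rightarrow> 'a set \<Rightarrow> nat \<Rightarrow> real \<Rightarrow> 'a \<Rightarrow> real \<Rightarrow> bool" where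
  "stop_test f F q \<epsilon> x \<delta> \<longleftrightarrow> phi_fun f F q \<delta> x \<le> \<epsilon> * chi q \<delta>"

definition admissible_step ::
    "('a::euclidean_space \<Rightarrow> real) \<Rightarrow> 'a set \<Rightarrow> nat \<Rightarrow> nat \<Rightarrow> real \<Rightarrow> real \<Rightarrow> real \<Rightarrow> real
      \<Rightarrow> 'a \<Rightarrow> real \<Rightarrow> 'a \<Rightarrow> real \<Rightarrow> bool" where
  "admissible_step f F p q \<beta> \<epsilon> \<omega> \<theta> x \<sigma> s \<delta> \<longleftrightarrow>
     x + s \<in> F \<and> 0 < \<delta> \<and> \<delta> \<le> 1 \<and>
     model f p \<beta> x \<sigma> s < model f p \<beta> x \<sigma> 0 \<and>
     (norm s \<ge> \<omega> * \<epsilon> powr (1 / (real (p - q) + \<beta>)) \<or>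
      phi_model (model f p \<beta> x \<sigma>) F x q \<delta> s
        \<le> \<theta> * norm s powr (real (p - q) + \<beta>) / gfact (p - q) \<beta> * chi q \<delta>)"

definition rho :: "('a::euclidean_space \<Rightarrow> real) \<Rightarrow> nat \<Rightarrow> 'a \<Rightarrow> 'a \<Rightarrow> real" where
  "rho f p x s = (f x - f (x + s)) / (taylor f p x 0 - taylor f p x s)"

definition sigma_update ::
    "real \<Rightarrow> real \<Rightarrow> real \<Rightarrow> real \<Rightarrow> real \<Rightarrow> real \<Rightarrow> real \<Rightarrow> real \<Rightarrow> real \<Rightarrow> bool" where
  "sigma_update \<sigma>_min \<eta>1 \<eta>2 \<gamma>1 \<gamma>2 \<gamma>3 r \<sigma> \<sigma>' \<longleftrightarrow>
     (if r \<ge> \<eta>2 then \<sigma>' \<in> {max \<sigma>_min (\<gamma>1 * \<sigma>)..\<sigma>}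
      else if r \<ge> \<eta>1 then \<sigma>' \<in> {\<sigma>..\<gamma>2 * \<sigma>}
      else \<sigma>' \<in> {\<gamma>2 * \<sigma>..\<gamma>3 * \<sigma>})"

definition successful ::
    "('a::euclidean_space \<Rightarrow> real) \<Rightarrow> nat \<Rightarrow> real \<Rightarrow> (nat \<Rightarrow> 'a) \<Rightarrow> (nat \<Rightarrow> 'a) \<Rightarrow> nat \<Rightarrow> bool" where
  "successful f p \<eta>1 x s k \<longleftrightarrow> rho f p (x k) (s k) \<ge> \<eta>1"

definition stops_in_step1 ::
    "('a::euclidean_space \<Rightarrow> real) \<Rightarrow> 'a set \<Rightarrow> nat \<Rightarrow> nat \<Rightarrow> real \<Rightarrow> real \<Rightarrow> real
      \<Rightarrow> (nat \<Rightarrow> 'a) \<Rightarrow> (nat \<Rightarrow> 'a) \<Rightarrow> (nat \<Rightarrow> real) \<Rightarrow> nat \<Rightarrow> bool" where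
  "stops_in_step1 f F p q \<epsilon> \<delta>_init \<eta>1 x s \<delta> k \<longleftrightarrow>
     (case k of
        0 \<Rightarrow> stop_test f F q \<epsilon> (x 0) \<delta>_init
      | Suc j \<Rightarrow> successful f p \<eta>1 x s j \<and> stop_test f F q \<epsilon> (x k) (\<delta> j))"

(* A complete execution of the algorithm, for one arbitrary resolution of all its choices.
   N is the number of iterations in which a trial point is computed and evaluated; it is
   infinite if the algorithm never stops. The iterates x k and weights \<sigma> k are meaningful for
   k \<le> N, the steps s k and radii \<delta> k for k < N; \<delta>_init is the initial radius (index -1).
   If N = enat K, the algorithm stops with output x K. *)
definition ARp_execution ::
    "('a::euclidean_space \<Rightarrow> real) \<Rightarrow> 'a set \<Rightarrow> nat \<Rightarrow> nat \<Rightarrow> real \<Rightarrow> real \<Rightarrow> real \<Rightarrow> real \<Rightarrow> real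
      \<Rightarrow> real \<Rightarrow> real \<Rightarrow> real \<Rightarrow> real \<Rightarrow> real \<Rightarrow> real \<Rightarrow> 'a \<Rightarrow> real
      \<Rightarrow> enat \<Rightarrow> (nat \<Rightarrow> 'a) \<Rightarrow> (nat \<Rightarrow> real) \<Rightarrow> (nat \<Rightarrow> 'a) \<Rightarrow> (nat \<Rightarrow> real) \<Rightarrow> bool" where
  "ARp_execution f F p q \<beta> \<epsilon> \<omega> \<theta> \<delta>_init \<sigma>_min \<eta>1 \<eta>2 \<gamma>1 \<gamma>2 \<gamma>3 x0 \<sigma>0 N x \<sigma> s \<delta> \<longleftrightarrow>
     x 0 = x0 \<and> \<sigma> 0 = \<sigma>0 \<and>
     (\<forall>k. enat k < N \<longrightarrow>
        \<not> stops_in_step1 f F p q \<epsilon> \<delta>_init \<eta>1 x s \<delta> k \<and>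
        admissible_step f F p q \<beta> \<epsilon> \<omega> \<theta> (x k) (\<sigma> k) (s k) (\<delta> k) \<and>
        x (Suc k) = (if successful f p \<eta>1 x s k then x k + s k else x k) \<and>
        sigma_update \<sigma>_min \<eta>1 \<eta>2 \<gamma>1 \<gamma>2 \<gamma>3 (rho f p (x k) (s k)) (\<sigma> k) (\<sigma> (Suc k))) \<and>
     (\<forall>K. N = enat K \<longrightarrow>
        stops_in_step1 f F p q \<epsilon> \<delta>_init \<eta>1 x s \<delta> K \<or>
        (\<nexists>s' \<delta>'. admissible_step f F p q \<beta> \<epsilon> \<omega> \<theta> (x K) (\<sigma> K) s' \<delta>'))"

end

(*
  For an objective with beta-Hoelder p-th derivative, the model and its derivatives of order j <= q
  approximate those of f at x + s up to (L + sigma) / (p - j + beta)! times norm s to the power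
  p - j + beta. Hence sigma never exceeds sigma_max, and a successful step that does not lead to
  termination has a length bounded below by a power of epsilon, so that it decreases f by a fixed
  amount; comparing the total decrease with f(x0) - f_low counts the successful iterations, and the
  bounds on sigma count the others. If no admissible step exists, then the model has no feasible
  decrease: a global minimizer of the model over the feasible set with smaller value would be
  admissible for a small radius. Then phi_fun is of higher than q-th order in the radius.

  Two ingredients have to hold with sharp constants. Derivatives are compared through tensors with
  mixed arguments d and s, while the Hoelder condition controls diagonal values only; Banach's theorem
  on symmetric multilinear forms says that this loses nothing. Moreover, the j-th directional derivative
  of the (p + beta)-th power of the norm is a Gegenbauer polynomial in the angle, which is largest at
  angle 0 as long as j < p + beta.
*)
theory Submission imports Defs begin

text \<open>The constants dictate the shape of the proof. Expanding the j-th derivative in direction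
  \<open>d\<close> along the segment from \<open>x\<close> to \<open>x + s\<close> leaves a
  remainder in which the p-th derivative has p - j arguments \<open>s\<close> and j arguments
  \<open>d\<close>; a polarization factor there would spoil (L + \<sigma> + \<theta>) / (p - q +
  \<beta>)!. On the other side, the Gegenbauer polynomial at angle 0 has the falling product (p +
  \<beta>)(p + \<beta> - 1)... as its value, which turns \<sigma> / (p + \<beta>)! into \<sigma> /
  (p - j + \<beta>)!. This is the shape of the Hoelder error, so the two add up to L + \<sigma>. The
  power of the norm need not be smooth at 0. Model derivatives are therefore computed at nonzero
  steps only; when no step exists, the origin itself minimizes the model, and there its values are
  used instead of its derivatives. An execution may a priori be infinite. All counts are bounded for
  every finite prefix, by a number independent of the prefix, and termination is a
  consequence.\<close>

section \<open>Symmetric multilinear forms\<close>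

text \<open>Linearity is demanded in the first slot only, since symmetry carries it to the others.
  Lists of other lengths are unconstrained.\<close>

definition symmetric_form :: "nat \<Rightarrow> ('a::real_vector list \<Rightarrow> real) \<Rightarrow> bool" where
  "symmetric_form n S \<longleftrightarrow>
     (\<forall>vs ws. length vs = n \<longrightarrow> mset vs = mset ws \<longrightarrow> S vs = S ws) \<and>
     (\<forall>vs. Suc (length vs) = n \<longrightarrow> linear (\<lambda>v. S (v # vs)))"

lemma symmetric_form_perm:
  "symmetric_form n S \<Longrightarrow> length vs = n \<Longrightarrow> mset vs = mset ws \<Longrightarrow> S vs = S ws"
  unfolding symmetric_form_def by blast

lemma symmetric_form_linear:
  "symmetric_form n S \<Longrightarrow> Suc (length vs) = n \<Longrightarrow> linear (\<lambda>v. S (v # vs))"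
  unfolding symmetric_form_def by blast

lemma symmetric_form_Cons:
  assumes "symmetric_form (Suc n) S"
  shows "symmetric_form n (\<lambda>vs. S (u # vs))"
  unfolding symmetric_form_def
proof (intro conjI allI impI)
  fix vs ws :: "'a list" assume "length vs = n" "mset vs = mset ws"
  then show "S (u # vs) = S (u # ws)"
    by (intro symmetric_form_perm[OF assms]) auto
next
  fix vs :: "'a list" assume l: "Suc (length vs) = n"
  have "(\<lambda>v. S (u # v # vs)) = (\<lambda>v. S (v # u # vs))"
    using l by (intro ext symmetric_form_perm[OF assms]) auto
  then show "linear (\<lambda>v. S (u # v # vs))"
    using symmetric_form_linear[OF assms, of "u # vs"] l by simp
qed

lemma symmetric_form_diff:
  assumes "symmetric_form n S" "symmetric_form n T"
  shows "symmetric_form n (\<lambda>vs. S vs - T vs)"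
  using assms unfolding symmetric_form_def by (auto intro!: linear_compose_sub)

lemma symmetric_form_basis:
  fixes S :: "'a::euclidean_space list \<Rightarrow> real"
  assumes "symmetric_form n S" "Suc (length vs) = n"
  shows "S (v # vs) = (\<Sum>b\<in>Basis. (v \<bullet> b) * S (b # vs))"
proof -
  interpret linear "\<lambda>v. S (v # vs)" by (rule symmetric_form_linear[OF assms])
  have "S (v # vs) = S ((\<Sum>b\<in>Basis. (v \<bullet> b) *\<^sub>R b) # vs)"
    by (simp add: euclidean_representation)
  also have "\<dots> = (\<Sum>b\<in>Basis. (v \<bullet> b) * S (b # vs))"
    by (simp add: sum scale)
  finally show ?thesis .
qed

text \<open>Crude: expanding argument after argument in the basis gives some constant. It serves
  where only finiteness matters, for instance of the supremum in the sharp bound below.\<close>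

lemma symmetric_form_bounded:
  fixes S :: "'a::euclidean_space list \<Rightarrow> real"
  assumes "symmetric_form n S"
  obtains C where "0 \<le> C" "\<And>vs. length vs = n \<Longrightarrow> \<bar>S vs\<bar> \<le> C * prod_list (map norm vs)"
proof -
  have "\<exists>C\<ge>0. \<forall>vs. length vs = n \<longrightarrow> \<bar>S vs\<bar> \<le> C * prod_list (map norm vs)"
    using assms
  proof (induction n arbitrary: S)
    case 0
    then show ?case by (intro exI[of _ "\<bar>S []\<bar>"]) auto
  next
    case (Suc n)
    have "\<exists>C\<ge>0. \<forall>vs. length vs = n \<longrightarrow> \<bar>S (b # vs)\<bar> \<le> C * prod_list (map norm vs)" for b
      using Suc.IH[OF symmetric_form_Cons[OF Suc.prems]] by simp
    then obtain C where C: "\<And>b. C b \<ge> 0"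
      "\<And>b vs. length vs = n \<Longrightarrow> \<bar>S (b # vs)\<bar> \<le> C b * prod_list (map norm vs)"
      by metis
    have "\<bar>S ws\<bar> \<le> (\<Sum>b\<in>Basis. C b) * prod_list (map norm ws)" if ws: "length ws = Suc n" for ws
    proof -
      obtain v vs where [simp]: "ws = v # vs" and l: "length vs = n"
        using ws by (cases ws) auto
      have "\<bar>S (v # vs)\<bar> \<le> (\<Sum>b\<in>Basis. \<bar>(v \<bullet> b) * S (b # vs)\<bar>)"
        using l by (subst symmetric_form_basis[OF Suc.prems]) auto
      also have "\<dots> \<le> (\<Sum>b\<in>Basis. norm v * (C b * prod_list (map norm vs)))"
        unfolding abs_mult using C(2)[OF l]
        by (intro sum_mono mult_mono) (auto simp: Basis_le_norm)
      finally show ?thesis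
        by (simp add: sum_distrib_left sum_distrib_right algebra_simps)
    qed
    then show ?case
      by (intro exI[of _ "\<Sum>b\<in>Basis. C b"]) (auto simp: C(1) intro!: sum_nonneg)
  qed
  then show ?thesis using that by blast
qed

lemma symmetric_form_replicate_scaleR:
  assumes "symmetric_form n S" "length us + m = n"
  shows "S (us @ replicate m (c *\<^sub>R v)) = c ^ m * S (us @ replicate m v)"
  using assms(2)
proof (induction m arbitrary: us)
  case 0
  then show ?case by simp
next
  case (Suc m)
  have "S (us @ replicate (Suc m) (c *\<^sub>R v)) = S ((us @ [c *\<^sub>R v]) @ replicate m (c *\<^sub>R v))"
    by simp
  also have "\<dots> = c ^ m * S ((us @ [c *\<^sub>R v]) @ replicate m v)"
    using Suc.prems by (intro Suc.IH) simp
  also have "S ((us @ [c *\<^sub>R v]) @ replicate m v) = S (c *\<^sub>R v # us @ replicate m v)"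
    using Suc.prems by (intro symmetric_form_perm[OF assms(1)]) auto
  also have "\<dots> = c * S (v # us @ replicate m v)"
    using linear_scale[OF symmetric_form_linear[OF assms(1), of "us @ replicate m v"]] Suc.prems by simp
  also have "S (v # us @ replicate m v) = S (us @ replicate (Suc m) v)"
    using Suc.prems by (intro symmetric_form_perm[OF assms(1)]) auto
  finally show ?case by simp
qed

text \<open>The parallelogram law: near-maximality of a symmetric bilinear form at \<open>(a, b)\<close> passes to
  the bisector of \<open>a\<close> and \<open>b\<close>.\<close>
lemma symmetric_form_bisector:
  fixes S :: "'a::euclidean_space list \<Rightarrow> real"
  assumes S: "symmetric_form n S" and n: "n = Suc (Suc (length ws))"
    and K: "\<And>vs. length vs = n \<Longrightarrow> \<bar>S vs\<bar> \<le> K * prod_list (map norm vs)"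
    and ws: "\<forall>w\<in>set ws. norm w = 1"
    and ab: "norm a = 1" "norm b = 1" "0 \<le> a \<bullet> b" and e: "0 \<le> e"
    and z: "z = (1 / norm (a + b)) *\<^sub>R (a + b)"
    and gt: "K - e < \<bar>S (a # b # ws)\<bar>"
  shows "K - 2 * e < \<bar>S (z # z # ws)\<bar>"
proof -
  define B where "B u v = S (u # v # ws)" for u v
  have lin: "linear (\<lambda>u. B u v)" for v
    unfolding B_def using n by (intro symmetric_form_linear[OF S]) auto
  have sym: "B u v = B v u" for u v
    unfolding B_def using n by (intro symmetric_form_perm[OF S]) auto
  have add: "B (u + v) w = B u w + B v w" for u v w using linear_add[OF lin] .
  have dif: "B (u - v) w = B u w - B v w" for u v w using linear_diff[OF lin] .
  have add2: "B w (u + v) = B w u + B w v" and dif2: "B w (u - v) = B w u - B w v" for u v w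
    using add[of u v w] dif[of u v w] by (simp_all add: sym[of _ w])
  have scl: "B (c *\<^sub>R u) w = c * B u w" for c u w using linear_scale[OF lin] by simp
  have scl2: "B w (c *\<^sub>R u) = c * B w u" for c u w using scl[of c u w] by (simp add: sym[of _ w])
  have pw: "prod_list (map norm ws) = 1"
    using ws by (induction ws) auto
  have bd: "\<bar>B u v\<bar> \<le> K * (norm u * norm v)" for u v
    unfolding B_def using K[of "u # v # ws"] n pw by simp
  \<comment> \<open>Polarization: 4 B(a, b) is nearly 4 K in absolute value, and B(a - b, a - b)
    accounts for at most K (4 - m) of it, so B(a + b, a + b) nearly attains K m.\<close>
  have pol: "B (a + b) (a + b) - B (a - b) (a - b) = 4 * B a b"
    by (simp add: add dif add2 dif2 sym[of b a])
  have na: "a \<bullet> a = 1" "b \<bullet> b = 1" using ab by (simp_all add: norm_eq_1)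
  have np: "(norm (a + b))\<^sup>2 = 2 + 2 * (a \<bullet> b)" "(norm (a - b))\<^sup>2 = 2 - 2 * (a \<bullet> b)"
    by (simp_all add: power2_norm_eq_inner inner_add inner_diff inner_commute na)
  define m where "m = (norm (a + b))\<^sup>2"
  have m: "m \<ge> 2" "(norm (a - b))\<^sup>2 = 4 - m" using ab(3) np m_def by auto
  have "\<bar>B (a - b) (a - b)\<bar> \<le> K * (4 - m)"
    using bd[of "a - b" "a - b"] m by (simp add: power2_eq_square)
  then have "4 * (K - e) - K * (4 - m) < \<bar>B (a + b) (a + b)\<bar>"
  proof -
    have "4 * x - w < \<bar>s\<bar>" if "\<bar>t\<bar> \<le> w" "x < \<bar>r\<bar>" "s - t = 4 * r" for x w r s t :: real
      using that by linarith
    from this[OF \<open>\<bar>B (a - b) (a - b)\<bar> \<le> K * (4 - m)\<close> gt[folded B_def] pol] show ?thesis .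
  qed
  then have "K * m - 4 * e < \<bar>B (a + b) (a + b)\<bar>" by (simp add: algebra_simps)
  moreover have "B z z = B (a + b) (a + b) / m"
    unfolding z by (simp add: scl scl2 m_def power2_eq_square)
  then have "\<bar>B z z\<bar> = \<bar>B (a + b) (a + b)\<bar> / m" using m by simp
  ultimately have "K - 4 * e / m < \<bar>B z z\<bar>"
    using m by (simp add: field_simps)
  \<comment> \<open>The angle condition gave m \<ge> 2; it limits the growth of the defect to a
    factor 2.\<close>
  moreover have "4 * e / m \<le> 2 * e"
    using m e by (simp add: field_simps mult_left_mono)
  ultimately show ?thesis unfolding B_def by linarith
qed

text \<open>Each round trades one \<open>a\<close> and one \<open>b\<close> for two copies of the
  bisector and doubles the defect; the surplus \<open>i\<close> and \<open>j\<close> copies stay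
  untouched.\<close>

lemma symmetric_form_bisector_iterate:
  fixes S :: "'a::euclidean_space list \<Rightarrow> real"
  assumes S: "symmetric_form n S"
    and K: "\<And>vs. length vs = n \<Longrightarrow> \<bar>S vs\<bar> \<le> K * prod_list (map norm vs)"
    and ab: "norm a = 1" "norm b = 1" "0 \<le> a \<bullet> b" and e: "0 \<le> e"
    and z: "z = (1 / norm (a + b)) *\<^sub>R (a + b)"
  shows "2 * k + i + j = n \<Longrightarrow>
    K - e < \<bar>S (replicate (k + i) a @ replicate (k + j) b)\<bar> \<Longrightarrow>
    K - 2 ^ k * e < \<bar>S (replicate (2 * k) z @ replicate i a @ replicate j b)\<bar>"
proof (induction k arbitrary: i j)
  case 0
  then show ?case by simp
next
  case (Suc k)
  have "a + b \<noteq> 0"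
    using ab by (metis add_eq_0_iff inner_minus_left inner_minus_right neg_0_le_iff_le
      norm_eq_1 not_one_le_zero)
  then have nz: "norm z = 1" by (simp add: z)
  define ws where "ws = replicate (2 * k) z @ replicate i a @ replicate j b"
  have "K - 2 ^ k * e < \<bar>S (replicate (2 * k) z @ replicate (Suc i) a @ replicate (Suc j) b)\<bar>"
    using Suc.prems by (intro Suc.IH) auto
  also have "S (replicate (2 * k) z @ replicate (Suc i) a @ replicate (Suc j) b) = S (a # b # ws)"
    unfolding ws_def using Suc.prems by (intro symmetric_form_perm[OF S]) auto
  finally have "K - 2 * (2 ^ k * e) < \<bar>S (z # z # ws)\<bar>"
    using Suc.prems nz ab e unfolding ws_def
    by (intro symmetric_form_bisector[OF S _ K _ ab _ z]) auto
  then show ?case by (simp add: ws_def)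
qed

text \<open>With m the norm of a + b, the two squared distances are 2 - m and 4 - m^2 = (2 - m)(2 +
  m). The halving makes repeated bisection converge, and the sign of the inner product allows it to
  be repeated.\<close>

lemma bisector_inner_dist:
  fixes a b :: "'a::real_inner"
  assumes ab: "norm a = 1" "norm b = 1" "0 \<le> a \<bullet> b"
    and z: "z = (1 / norm (a + b)) *\<^sub>R (a + b)"
  shows "norm z = 1" "0 \<le> z \<bullet> b" "(norm (z - b))\<^sup>2 \<le> (norm (a - b))\<^sup>2 / 2"
proof -
  have na: "a \<bullet> a = 1" "b \<bullet> b = 1" using ab by (simp_all add: norm_eq_1)
  define m where "m = norm (a + b)"
  have m2: "m\<^sup>2 = 2 + 2 * (a \<bullet> b)"
    by (simp add: m_def power2_norm_eq_inner inner_add inner_commute na)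
  have m: "0 < m" using m2 ab(3) unfolding m_def
    by (metis add_nonneg_pos add.commute mult_nonneg_nonneg norm_ge_zero order_le_less power_zero_numeral zero_less_numeral less_numeral_extra(3) zero_le_numeral)
  show nz: "norm z = 1" using m by (simp add: z m_def)
  have "z \<bullet> b = (a \<bullet> b + 1) / m" by (simp add: z inner_add m_def na)
  also have "\<dots> = m / 2" using m m2 by (simp add: field_simps power2_eq_square)
  finally have zb: "z \<bullet> b = m / 2" .
  then show "0 \<le> z \<bullet> b" using m by simp
  have "(norm (z - b))\<^sup>2 = 2 - m"
    using nz zb by (simp add: power2_norm_eq_inner inner_diff inner_commute na norm_eq_1)
  moreover have "(norm (a - b))\<^sup>2 = 4 - m\<^sup>2"
    by (simp add: m2 power2_norm_eq_inner inner_diff inner_commute na)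
  moreover have "m \<le> 2" using norm_triangle_ineq[of a b] ab m_def by simp
  then have "0 \<le> (2 - m) * m" using m by simp
  then have "2 * (2 - m) \<le> 4 - m\<^sup>2" by (simp add: algebra_simps power2_eq_square)
  ultimately show "(norm (z - b))\<^sup>2 \<le> (norm (a - b))\<^sup>2 / 2" by simp
qed

text \<open>Telescoping: exchanging a single \<open>a\<close> for \<open>b\<close> costs at most
  \<open>K * norm (a - b)\<close> by linearity.\<close>

lemma symmetric_form_replicate_diff_le:
  fixes S :: "'a::euclidean_space list \<Rightarrow> real"
  assumes S: "symmetric_form n S"
    and K: "\<And>vs. length vs = n \<Longrightarrow> \<bar>S vs\<bar> \<le> K * prod_list (map norm vs)"
    and ab: "norm a = 1" "norm b = 1"
  shows "length us + m = n \<Longrightarrow> \<forall>u\<in>set us. norm u = 1 \<Longrightarrow>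
    \<bar>S (us @ replicate m a) - S (us @ replicate m b)\<bar> \<le> m * (K * norm (a - b))"
proof (induction m arbitrary: us)
  case 0
  then show ?case by simp
next
  case (Suc m)
  let ?w = "us @ replicate m a"
  have p: "S (us @ replicate (Suc m) a) = S (a # ?w)"
    "S ((us @ [b]) @ replicate m a) = S (b # ?w)"
    using Suc.prems by (intro symmetric_form_perm[OF S]; auto)+
  have "S (us @ replicate (Suc m) a) - S ((us @ [b]) @ replicate m a) = S ((a - b) # ?w)"
    unfolding p using linear_diff[OF symmetric_form_linear[OF S, of ?w]] Suc.prems by simp
  also have "\<bar>\<dots>\<bar> \<le> K * norm (a - b)"
  proof -
    have "prod_list (map norm us) = 1"
      using Suc.prems(2) by (induction us) auto
    then show ?thesis
      using K[of "(a - b) # ?w"] Suc.prems ab by (simp add: )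
  qed
  finally have "\<bar>S (us @ replicate (Suc m) a) - S ((us @ [b]) @ replicate m a)\<bar> \<le> K * norm (a - b)" .
  moreover have "\<bar>S ((us @ [b]) @ replicate m a) - S ((us @ [b]) @ replicate m b)\<bar> \<le> m * (K * norm (a - b))"
    using Suc.prems ab by (intro Suc.IH) auto
  ultimately show ?case
    by (simp add: algebra_simps)
qed

text \<open>Banach's theorem. The induction hypothesis, applied with one argument fixed, shows that
  the norm \<open>K\<close> of the form is already the supremum over arguments (y, x, ..., x).
  Bisection then moves the two vectors together until the diagonal bound applies. Near-maximizers
  replace maximizers, so no compactness is involved.\<close>

theorem symmetric_form_diagonal_bound:
  fixes S :: "'a::euclidean_space list \<Rightarrow> real"
  assumes "symmetric_form n S" "0 \<le> M"
    and "\<And>v. \<bar>S (replicate n v)\<bar> \<le> M * norm v ^ n"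
    and "length vs = n"
  shows "\<bar>S vs\<bar> \<le> M * prod_list (map norm vs)"
  using assms
proof (induction n arbitrary: S M vs)
  case 0
  then show ?case by simp
next
  case (Suc n)
  note S = Suc.prems(1)
  obtain C where C: "0 \<le> C" "\<And>vs. length vs = Suc n \<Longrightarrow> \<bar>S vs\<bar> \<le> C * prod_list (map norm vs)"
    using symmetric_form_bounded[OF S] by blast
  define A where "A = {\<bar>S (y # replicate n x)\<bar> | x y. norm x = 1 \<and> norm y = 1}"
  define K where "K = Sup A"
  have bdd: "bdd_above A"
  proof (rule bdd_aboveI)
    fix a assume "a \<in> A"
    then obtain x y where "a = \<bar>S (y # replicate n x)\<bar>" "norm x = 1" "norm y = 1"
      unfolding A_def by auto
    then show "a \<le> C" using C(2)[of "y # replicate n x"] by simp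
  qed
  obtain u :: 'a where u: "norm u = 1" using vector_choose_size[of 1] by auto
  have neA: "A \<noteq> {}" unfolding A_def using u by auto
  have K0: "0 \<le> K"
    unfolding K_def using u by (intro cSup_upper2[OF _ _ bdd, of "\<bar>S (u # replicate n u)\<bar>"]) (auto simp: A_def)
  have Kx: "\<bar>S (y # replicate n x)\<bar> \<le> K * norm y * norm x ^ n" for x y
  proof -
    define unit where "unit v = (if v = 0 then u else (1 / norm v) *\<^sub>R v)" for v
    have unit: "norm (unit v) = 1" "v = norm v *\<^sub>R unit v" for v
      using u by (auto simp: unit_def)
    define x' where "x' = unit x"
    define y' where "y' = unit y"
    note u' = unit(1)[of x, folded x'_def] unit(1)[of y, folded y'_def]
    note xy = unit(2)[of x, folded x'_def] unit(2)[of y, folded y'_def]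
    have "S (y # replicate n x) = norm x ^ n * S ([y] @ replicate n x')"
      using symmetric_form_replicate_scaleR[OF S, of "[y]" n "norm x" x', folded xy(1)] by simp
    also have "S ([y] @ replicate n x') = norm y * S (y' # replicate n x')"
      using linear_scale[OF symmetric_form_linear[OF S, of "replicate n x'"], of "norm y" y', folded xy(2)]
      by simp
    finally have eq: "\<bar>S (y # replicate n x)\<bar> = norm y * norm x ^ n * \<bar>S (y' # replicate n x')\<bar>"
      by (simp add: abs_mult)
    have "\<bar>S (y' # replicate n x')\<bar> \<le> K"
      unfolding K_def using u' by (intro cSup_upper[OF _ bdd]) (auto simp: A_def)
    then have "norm y * norm x ^ n * \<bar>S (y' # replicate n x')\<bar> \<le> norm y * norm x ^ n * K"
      by (intro mult_left_mono) auto
    then show ?thesis by (simp add: eq algebra_simps)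
  qed
  have Kall: "\<bar>S ws\<bar> \<le> K * prod_list (map norm ws)" if "length ws = Suc n" for ws
  proof -
    obtain y vs where [simp]: "ws = y # vs" and l: "length vs = n" using \<open>length ws = Suc n\<close> by (cases ws) auto
    have "\<bar>S (y # vs)\<bar> \<le> K * norm y * prod_list (map norm vs)"
      using l by (intro Suc.IH[OF symmetric_form_Cons[OF S]] Kx mult_nonneg_nonneg K0 norm_ge_zero)
    then show ?thesis by (simp add: algebra_simps)
  qed
  \<comment> \<open>The vectors get closer with \<open>j\<close> while the defect \<open>e\<close>
    remains arbitrary; the multiplicity \<open>i\<close> is left open because bisection changes
    it.\<close>
  have near: "\<exists>a b i. i \<le> Suc n \<and> norm a = 1 \<and> norm b = 1 \<and> 0 \<le> a \<bullet> b \<and>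
      (norm (a - b))\<^sup>2 \<le> 2 * (1/2) ^ j \<and> K - e < \<bar>S (replicate i a @ replicate (Suc n - i) b)\<bar>"
    if "0 < e" for j :: nat and e :: real
    using that
  proof (induction j arbitrary: e)
    case 0
    obtain x y where xy: "norm x = 1" "norm y = 1" "K - e < \<bar>S (y # replicate n x)\<bar>"
    proof -
      have "\<exists>a\<in>A. K - e < a"
        using less_cSup_iff[OF neA bdd, of "K - e"] 0 by (simp add: K_def)
      then show ?thesis using that unfolding A_def by blast
    qed
    \<comment> \<open>Flipping the sign of \<open>y\<close> keeps the absolute value and makes the
      angle at most a right one, as bisection requires.\<close>
    define b where "b = (if 0 \<le> x \<bullet> y then y else - y)"
    have b: "norm b = 1" "0 \<le> x \<bullet> b" using xy by (auto simp: b_def)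
    have "S (- y # replicate n x) = - S (y # replicate n x)"
      using linear_neg[OF symmetric_form_linear[OF S, of "replicate n x"]] by simp
    then have "\<bar>S (y # replicate n x)\<bar> = \<bar>S (b # replicate n x)\<bar>" by (simp add: b_def)
    also have "S (b # replicate n x) = S (replicate n x @ replicate (Suc n - n) b)"
      by (intro symmetric_form_perm[OF S]) auto
    finally have "K - e < \<bar>S (replicate n x @ replicate (Suc n - n) b)\<bar>" using xy by simp
    moreover have "(norm (x - b))\<^sup>2 \<le> 2 * (1/2) ^ 0"
      using b xy by (simp add: power2_norm_eq_inner inner_diff inner_commute norm_eq_1)
    ultimately show ?case using b xy by (intro exI[of _ x] exI[of _ b] exI[of _ n]) auto
  next
    case (Suc j)
    \<comment> \<open>At most \<open>Suc n\<close> bisections follow, each doubling the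
      defect.\<close>
    define e' where "e' = e / 2 ^ Suc n"
    have e': "0 < e'" using Suc.prems by (simp add: e'_def)
    then obtain a b i where h: "i \<le> Suc n" "norm a = 1" "norm b = 1" "0 \<le> a \<bullet> b"
      "(norm (a - b))\<^sup>2 \<le> 2 * (1/2) ^ j" "K - e' < \<bar>S (replicate i a @ replicate (Suc n - i) b)\<bar>"
      using Suc.IH by blast
    \<comment> \<open>The case where \<open>a\<close> is not the more frequent vector: every copy of
      it is paired with a \<open>b\<close>, so that only \<open>z\<close> and \<open>b\<close>
      remain. In the other case the roles are exchanged.\<close>
    have step: ?case
      if h: "norm a = 1" "norm b = 1" "0 \<le> a \<bullet> b" "(norm (a - b))\<^sup>2 \<le> 2 * (1/2) ^ j"
        and ij: "2 * i \<le> Suc n" "K - e' < \<bar>S (replicate i a @ replicate (Suc n - i) b)\<bar>" for a b i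
    proof -
      define z where "z = (1 / norm (a + b)) *\<^sub>R (a + b)"
      have "K - 2 ^ i * e' < \<bar>S (replicate (2 * i) z @ replicate 0 a @ replicate (Suc n - 2 * i) b)\<bar>"
        using ij h e' by (intro symmetric_form_bisector_iterate[OF S Kall _ _ _ _ z_def]) (auto simp: Suc_diff_le)
      moreover have "2 ^ i * e' \<le> e"
      proof -
        have "(2::real) ^ i \<le> 2 ^ Suc n" using ij by (intro power_increasing) auto
        then show ?thesis using Suc.prems by (simp add: e'_def field_simps)
      qed
      moreover have "norm z = 1" "0 \<le> z \<bullet> b" "(norm (z - b))\<^sup>2 \<le> (norm (a - b))\<^sup>2 / 2"
        using bisector_inner_dist[OF h(1-3) z_def] by auto
      ultimately show ?case using h ij
        by (intro exI[of _ z] exI[of _ b] exI[of _ "2 * i"]) auto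
    qed
    show ?case
    proof (cases "2 * i \<le> Suc n")
      case True
      then show ?thesis using step h by blast
    next
      case False
      have "S (replicate i a @ replicate (Suc n - i) b) = S (replicate (Suc n - i) b @ replicate (Suc n - (Suc n - i)) a)"
        using h(1) by (intro symmetric_form_perm[OF S]) auto
      then show ?thesis
        using h False by (intro step[of b a "Suc n - i"]) (auto simp: inner_commute norm_minus_commute)
    qed
  qed
  have "K \<le> M"
  proof (rule ccontr)
    assume "\<not> K \<le> M"
    then have KM: "0 < K - M" "0 < K" using Suc.prems(2) by auto
    \<comment> \<open>Turning up to \<open>Suc n\<close> copies of \<open>b\<close> into
      \<open>a\<close> then costs at most half of the gap \<open>K - M\<close>; the other half is
      the defect of the near-maximizer.\<close>
    define c where "c = (K - M) / (2 * (Suc n * K))"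
    have c: "0 < c" using KM by (simp add: c_def)
    obtain j where j: "(1/2) ^ j < c\<^sup>2 / 2"
      using real_arch_pow_inv[of "c\<^sup>2 / 2" "1/2"] c by auto
    obtain a b i where h: "i \<le> Suc n" "norm a = 1" "norm b = 1"
      "(norm (a - b))\<^sup>2 \<le> 2 * (1/2) ^ j"
      "K - (K - M) / 2 < \<bar>S (replicate i a @ replicate (Suc n - i) b)\<bar>"
      using near[of "(K - M) / 2" j] KM by auto
    have "(norm (a - b))\<^sup>2 < c\<^sup>2" using h(4) j by linarith
    then have nab: "norm (b - a) < c" using c
      by (metis less_eq_real_def norm_minus_commute power_less_imp_less_base)
    have "\<bar>S (replicate i a @ replicate (Suc n - i) b) - S (replicate i a @ replicate (Suc n - i) a)\<bar>
      \<le> (Suc n - i) * (K * norm (b - a))"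
      using h by (intro symmetric_form_replicate_diff_le[OF S Kall]) auto
    also have "\<dots> \<le> Suc n * (K * c)"
      using nab KM by (intro mult_mono) auto
    also have "\<dots> = (K - M) / 2" using KM by (simp add: c_def del: of_nat_Suc)
    finally have d: "\<bar>S (replicate i a @ replicate (Suc n - i) b) - S (replicate i a @ replicate (Suc n - i) a)\<bar>
      \<le> (K - M) / 2" .
    have "\<bar>x\<bar> \<le> \<bar>y\<bar> + \<bar>x - y\<bar>" for x y :: real by linarith
    note this[of "S (replicate i a @ replicate (Suc n - i) b)" "S (replicate i a @ replicate (Suc n - i) a)"]
    also note d
    finally have "M < \<bar>S (replicate i a @ replicate (Suc n - i) a)\<bar>"
      using h(5) by (simp add: field_simps)
    also have "replicate i a @ replicate (Suc n - i) a = replicate (Suc n) a"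
      using h(1) by (simp add: replicate_add[symmetric] del: replicate_Suc)
    also have "\<bar>S (replicate (Suc n) a)\<bar> \<le> M * norm a ^ Suc n" by (rule Suc.prems(3))
    finally show False using h by simp
  qed
  then have "K * prod_list (map norm vs) \<le> M * prod_list (map norm vs)"
    by (intro mult_right_mono prod_list_nonneg) auto
  with Kall[OF Suc.prems(4)] show ?case by linarith
qed

section \<open>Symmetry of higher derivatives\<close>

lemma has_derivative_imp_line_derivative:
  fixes g :: "'a::real_normed_vector \<Rightarrow> real"
  assumes "(g has_derivative D) (at (x + t *\<^sub>R v))"
  shows "((\<lambda>t. g (x + t *\<^sub>R v)) has_real_derivative D v) (at t)"
proof -
  interpret D: bounded_linear D using assms by (rule has_derivative_bounded_linear)
  have "((\<lambda>t. g (x + t *\<^sub>R v)) has_derivative (\<lambda>h. D (h *\<^sub>R v))) (at t)"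
    using assms by (auto intro!: derivative_eq_intros has_derivative_compose[of "\<lambda>t. x + t *\<^sub>R v" _ t UNIV g, unfolded o_def])
  moreover have "(\<lambda>h. D (h *\<^sub>R v)) = (*) (D v)" by (auto simp: D.scaleR)
  ultimately show ?thesis by (simp add: has_field_derivative_def)
qed

lemma frechet_derivative_line_derivative:
  fixes g :: "'a::real_normed_vector \<Rightarrow> real"
  assumes "g differentiable (at (x + t *\<^sub>R v))"
  shows "((\<lambda>t. g (x + t *\<^sub>R v)) has_real_derivative frechet_derivative g (at (x + t *\<^sub>R v)) v) (at t)"
  using assms by (intro has_derivative_imp_line_derivative) (simp add: frechet_derivative_works)

text \<open>The mean value theorem twice: along \<open>u\<close> for the difference of
  \<open>g\<close> on two parallel lines, then along \<open>v\<close> for the derivative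
  obtained.\<close>

lemma second_difference_mean_value:
  fixes g :: "'a::real_normed_vector \<Rightarrow> real"
  assumes g: "\<And>y. g differentiable (at y)"
    and gu: "\<And>y. (\<lambda>x. frechet_derivative g (at x) u) differentiable (at y)"
    and h: "0 < h"
  obtains a b where "0 < a" "a < h" "0 < b" "b < h"
    "g (x + h *\<^sub>R u + h *\<^sub>R v) - g (x + h *\<^sub>R u) - g (x + h *\<^sub>R v) + g x =
      h\<^sup>2 * frechet_derivative (\<lambda>x. frechet_derivative g (at x) u) (at (x + a *\<^sub>R u + b *\<^sub>R v)) v"
proof -
  define G where "G = (\<lambda>x. frechet_derivative g (at x) u)"
  define \<phi> where "\<phi> t = g ((x + h *\<^sub>R v) + t *\<^sub>R u) - g (x + t *\<^sub>R u)" for t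
  have d: "(\<phi> has_real_derivative G ((x + h *\<^sub>R v) + t *\<^sub>R u) - G (x + t *\<^sub>R u)) (at t)" for t
    unfolding \<phi>_def G_def by (intro DERIV_diff frechet_derivative_line_derivative g)
  obtain a where a: "0 < a" "a < h" "\<phi> h - \<phi> 0 = (h - 0) * (G ((x + h *\<^sub>R v) + a *\<^sub>R u) - G (x + a *\<^sub>R u))"
    using MVT2[OF h, of \<phi> "\<lambda>t. G ((x + h *\<^sub>R v) + t *\<^sub>R u) - G (x + t *\<^sub>R u)"] d by blast
  have d2: "((\<lambda>t. G ((x + a *\<^sub>R u) + t *\<^sub>R v)) has_real_derivative
      frechet_derivative G (at ((x + a *\<^sub>R u) + t *\<^sub>R v)) v) (at t)" for t
    by (intro frechet_derivative_line_derivative) (simp add: G_def gu)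
  obtain b where b: "0 < b" "b < h" "G ((x + a *\<^sub>R u) + h *\<^sub>R v) - G ((x + a *\<^sub>R u) + 0 *\<^sub>R v) =
      (h - 0) * frechet_derivative G (at ((x + a *\<^sub>R u) + b *\<^sub>R v)) v"
    using MVT2[OF h, of "\<lambda>t. G ((x + a *\<^sub>R u) + t *\<^sub>R v)"
        "\<lambda>t. frechet_derivative G (at ((x + a *\<^sub>R u) + t *\<^sub>R v)) v"] d2 by blast
  have "g (x + h *\<^sub>R u + h *\<^sub>R v) - g (x + h *\<^sub>R u) - g (x + h *\<^sub>R v) + g x = \<phi> h - \<phi> 0"
    by (simp add: \<phi>_def algebra_simps)
  also have "\<dots> = h * (G ((x + a *\<^sub>R u) + h *\<^sub>R v) - G ((x + a *\<^sub>R u) + 0 *\<^sub>R v))"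
    unfolding a(3) by (simp add: algebra_simps)
  also have "\<dots> = h\<^sup>2 * frechet_derivative G (at (x + a *\<^sub>R u + b *\<^sub>R v)) v"
    unfolding b(3) by (simp add: power2_eq_square)
  finally show ?thesis using that a b unfolding G_def by blast
qed

text \<open>The second difference does not see the order of \<open>u\<close> and \<open>v\<close>,
  so the mixed derivatives agree at pairs of points arbitrarily close to \<open>x\<close>;
  continuity does the rest.\<close>

lemma second_derivative_symmetric:
  fixes g :: "'a::real_normed_vector \<Rightarrow> real"
  assumes g: "\<And>y. g differentiable (at y)"
    and gu: "\<And>y. (\<lambda>x. frechet_derivative g (at x) u) differentiable (at y)"
    and gv: "\<And>y. (\<lambda>x. frechet_derivative g (at x) v) differentiable (at y)"
    and cu: "continuous_on UNIV (\<lambda>y. frechet_derivative (\<lambda>x. frechet_derivative g (at x) u) (at y) v)"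
    and cv: "continuous_on UNIV (\<lambda>y. frechet_derivative (\<lambda>x. frechet_derivative g (at x) v) (at y) u)"
  shows "frechet_derivative (\<lambda>x. frechet_derivative g (at x) u) (at x) v =
    frechet_derivative (\<lambda>x. frechet_derivative g (at x) v) (at x) u"
proof -
  define U where "U = (\<lambda>y. frechet_derivative (\<lambda>x. frechet_derivative g (at x) u) (at y) v)"
  define V where "V = (\<lambda>y. frechet_derivative (\<lambda>x. frechet_derivative g (at x) v) (at y) u)"
  have "\<exists>a b c d. \<bar>a\<bar> \<le> h \<and> \<bar>b\<bar> \<le> h \<and> \<bar>c\<bar> \<le> h \<and> \<bar>d\<bar> \<le> h \<and>
      U (x + a *\<^sub>R u + b *\<^sub>R v) = V (x + c *\<^sub>R v + d *\<^sub>R u)" if h: "0 < h" for h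
  proof -
    obtain a b where ab: "0 < a" "a < h" "0 < b" "b < h"
      "g (x + h *\<^sub>R u + h *\<^sub>R v) - g (x + h *\<^sub>R u) - g (x + h *\<^sub>R v) + g x = h\<^sup>2 * U (x + a *\<^sub>R u + b *\<^sub>R v)"
      using second_difference_mean_value[OF g gu h, of x v] unfolding U_def by blast
    obtain c d where cd: "0 < c" "c < h" "0 < d" "d < h"
      "g (x + h *\<^sub>R v + h *\<^sub>R u) - g (x + h *\<^sub>R v) - g (x + h *\<^sub>R u) + g x = h\<^sup>2 * V (x + c *\<^sub>R v + d *\<^sub>R u)"
      using second_difference_mean_value[OF g gv h, of x u] unfolding V_def by blast
    have "x + h *\<^sub>R u + h *\<^sub>R v = x + h *\<^sub>R v + h *\<^sub>R u" by (simp add: algebra_simps)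
    then have "h\<^sup>2 * U (x + a *\<^sub>R u + b *\<^sub>R v) = h\<^sup>2 * V (x + c *\<^sub>R v + d *\<^sub>R u)"
      using ab(5) cd(5) by (simp only:)
    then have "U (x + a *\<^sub>R u + b *\<^sub>R v) = V (x + c *\<^sub>R v + d *\<^sub>R u)" using h by simp
    then show ?thesis using ab cd by (intro exI[of _ a] exI[of _ b] exI[of _ c] exI[of _ d]) auto
  qed
  then have "\<forall>n::nat. \<exists>a b c d. \<bar>a\<bar> \<le> 1 / Suc n \<and> \<bar>b\<bar> \<le> 1 / Suc n \<and> \<bar>c\<bar> \<le> 1 / Suc n \<and> \<bar>d\<bar> \<le> 1 / Suc n \<and>
      U (x + a *\<^sub>R u + b *\<^sub>R v) = V (x + c *\<^sub>R v + d *\<^sub>R u)" by simp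
  then obtain a b c d where s: "\<And>n::nat. \<bar>a n\<bar> \<le> 1 / Suc n" "\<And>n. \<bar>b n\<bar> \<le> 1 / Suc n"
      "\<And>n. \<bar>c n\<bar> \<le> 1 / Suc n" "\<And>n. \<bar>d n\<bar> \<le> 1 / Suc n"
      and eq: "\<And>n. U (x + a n *\<^sub>R u + b n *\<^sub>R v) = V (x + c n *\<^sub>R v + d n *\<^sub>R u)"
    by metis
  have z: "r \<longlonglongrightarrow> 0" if "\<And>n::nat. \<bar>r n\<bar> \<le> 1 / Suc n" for r :: "nat \<Rightarrow> real"
    using that by (intro Lim_null_comparison[OF _ LIMSEQ_inverse_real_of_nat])
      (simp add: inverse_eq_divide del: of_nat_Suc)
  have "(\<lambda>n. x + a n *\<^sub>R u + b n *\<^sub>R v) \<longlonglongrightarrow> x + 0 *\<^sub>R u + 0 *\<^sub>R v"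
    by (intro tendsto_intros z s)
  then have "(\<lambda>n. x + a n *\<^sub>R u + b n *\<^sub>R v) \<longlonglongrightarrow> x" by simp
  then have "(\<lambda>n. U (x + a n *\<^sub>R u + b n *\<^sub>R v)) \<longlonglongrightarrow> U x"
    using cu unfolding U_def[symmetric]
    by (intro isCont_tendsto_compose[where g = U]) (simp_all add: continuous_on_eq_continuous_at)
  moreover have "(\<lambda>n. x + c n *\<^sub>R v + d n *\<^sub>R u) \<longlonglongrightarrow> x + 0 *\<^sub>R v + 0 *\<^sub>R u"
    by (intro tendsto_intros z s)
  then have "(\<lambda>n. x + c n *\<^sub>R v + d n *\<^sub>R u) \<longlonglongrightarrow> x" by simp
  then have "(\<lambda>n. V (x + c n *\<^sub>R v + d n *\<^sub>R u)) \<longlonglongrightarrow> V x"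
    using cv unfolding V_def[symmetric]
    by (intro isCont_tendsto_compose[where g = V]) (simp_all add: continuous_on_eq_continuous_at)
  ultimately have "U x = V x" unfolding eq by (rule LIMSEQ_unique)
  then show ?thesis by (simp add: U_def V_def)
qed

lemma nabla_swap:
  assumes f: "cont_differentiable p f" and l: "Suc (Suc (length vs)) \<le> p"
  shows "nabla f (u # v # vs) x = nabla f (v # u # vs) x"
proof -
  have d: "nabla f ws differentiable (at y)" if "length ws < p" for ws y
    using f that unfolding cont_differentiable_def by blast
  have c: "continuous_on UNIV (nabla f ws)" if "length ws \<le> p" for ws
    using f that unfolding cont_differentiable_def by blast
  show ?thesis
    \<comment> \<open>The head of a list is the direction differentiated last, hence the order
      \<open>v u\<close> here.\<close>
    using second_derivative_symmetric[of "nabla f vs" v u x] l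
      d[of vs] d[of "u # vs"] d[of "v # vs"] c[of "u # v # vs"] c[of "v # u # vs"]
    by simp
qed

text \<open>Adjacent transpositions generate all permutations.\<close>
lemma nabla_perm:
  assumes f: "cont_differentiable p f"
  shows "length vs \<le> p \<Longrightarrow> mset vs = mset ws \<Longrightarrow> nabla f vs = nabla f ws"
proof (induction "length vs" arbitrary: vs ws rule: less_induct)
  case less
  show ?case
  proof (cases vs)
    case Nil
    with less.prems show ?thesis by simp
  next
    case (Cons v vs')
    then obtain w ws' where w: "ws = w # ws'" using less.prems by (cases ws) auto
    show ?thesis
    proof (cases "v = w")
      case True
      with less.prems w Cons have "nabla f vs' = nabla f ws'" by (intro less.hyps) auto
      with True w Cons show ?thesis by simp
    next
      case False
      have m: "add_mset v (mset vs') = add_mset w (mset ws')" using less.prems w Cons by simp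
      have "w \<in># add_mset v (mset vs')" unfolding m by simp
      then have "w \<in># mset vs'" using False by simp
      then obtain K where K: "mset vs' = add_mset w K" by (meson multi_member_split)
      with m have K': "mset ws' = add_mset v K" by (simp add: add_mset_commute)
      obtain us where us: "mset us = K" using ex_mset by blast
      have lu: "length vs' = Suc (length us)"
        by (metis K us mset.simps(2) size_mset length_Cons)
      \<comment> \<open>An equation between functions of the base point, which can therefore be
        differentiated once more along \<open>v\<close>.\<close>
      have "nabla f vs' = nabla f (w # us)"
        using less.prems Cons K us by (intro less.hyps) simp_all
      then have "nabla f vs = nabla f (v # w # us)" using Cons by simp
      also have "\<dots> = nabla f (w # v # us)"
        using less.prems Cons lu by (intro ext nabla_swap[OF f]) auto
      also have "nabla f (v # us) = nabla f ws'"
        using less.prems Cons K' us lu by (intro less.hyps) simp_all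
      then have "nabla f (w # v # us) = nabla f ws" using w by simp
      finally show ?thesis .
    qed
  qed
qed

lemma nabla_symmetric_form:
  assumes f: "cont_differentiable p f" and n: "n \<le> p"
  shows "symmetric_form n (\<lambda>vs. nabla f vs x)"
  unfolding symmetric_form_def
proof (intro conjI allI impI)
  fix vs ws :: "'a list" assume "length vs = n" "mset vs = mset ws"
  then show "nabla f vs x = nabla f ws x"
    using n nabla_perm[OF f, of vs ws] by simp
next
  fix vs :: "'a list" assume "Suc (length vs) = n"
  then have "nabla f vs differentiable (at x)"
    using f n unfolding cont_differentiable_def by simp
  then show "linear (\<lambda>v. nabla f (v # vs) x)"
    by (simp add: linear_frechet_derivative)
qed

lemma nabla_line_derivative:
  assumes f: "cont_differentiable p f" and "length vs < p"
  shows "((\<lambda>t. nabla f vs (x + t *\<^sub>R s)) has_real_derivative nabla f (s # vs) (x + t *\<^sub>R s)) (at t)"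
  using assms unfolding nabla.simps
  by (intro frechet_derivative_line_derivative) (simp add: cont_differentiable_def)

text \<open>Expanding one copy of \<open>y\<close> in the basis leaves products of a linear factor
  and a form with one \<open>y\<close> fewer, ready for the product rule and induction. For m = 0
  the truncated \<open>m - 1\<close> is harmless because of the factor m.\<close>

lemma symmetric_form_has_derivative:
  fixes S :: "'a::euclidean_space list \<Rightarrow> real"
  assumes S: "symmetric_form n S"
  shows "length us + m = n \<Longrightarrow>
    ((\<lambda>y. S (us @ replicate m y)) has_derivative (\<lambda>h. m * S (h # us @ replicate (m - 1) y))) (at y)"
proof (induction m arbitrary: us)
  case 0
  then show ?case by simp
next
  case (Suc m)
  have e: "S (us @ replicate (Suc m) y) = (\<Sum>b\<in>Basis. (y \<bullet> b) * S ((b # us) @ replicate m y))" for y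
  proof -
    have "S (us @ replicate (Suc m) y) = S (y # us @ replicate m y)"
      using Suc.prems by (intro symmetric_form_perm[OF S]) auto
    also have "\<dots> = (\<Sum>b\<in>Basis. (y \<bullet> b) * S (b # us @ replicate m y))"
      using Suc.prems by (intro symmetric_form_basis[OF S]) auto
    finally show ?thesis by simp
  qed
  have IH: "((\<lambda>y. S ((b # us) @ replicate m y)) has_derivative
      (\<lambda>h. m * S (h # (b # us) @ replicate (m - 1) y))) (at y)" for b
    using Suc.prems by (intro Suc.IH) auto
  have "((\<lambda>y. \<Sum>b\<in>Basis. (y \<bullet> b) * S ((b # us) @ replicate m y)) has_derivative
     (\<lambda>h. \<Sum>b\<in>Basis. (y \<bullet> b) * (m * S (h # (b # us) @ replicate (m - 1) y)) + (h \<bullet> b) * S ((b # us) @ replicate m y))) (at y)"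
    by (intro has_derivative_sum has_derivative_mult IH has_derivative_inner_left has_derivative_ident)
  moreover have "(\<Sum>b\<in>Basis. (y \<bullet> b) * (m * S (h # (b # us) @ replicate (m - 1) y)) + (h \<bullet> b) * S ((b # us) @ replicate m y))
      = Suc m * S (h # us @ replicate (Suc m - 1) y)" for h
  proof -
    have 1: "(\<Sum>b\<in>Basis. (h \<bullet> b) * S ((b # us) @ replicate m y)) = S (h # us @ replicate m y)"
      using symmetric_form_basis[OF S, of "us @ replicate m y" h] Suc.prems by simp
    have 2: "(\<Sum>b\<in>Basis. (y \<bullet> b) * (m * S (h # (b # us) @ replicate (m - 1) y))) = m * S (h # us @ replicate m y)"
    proof (cases m)
      case 0
      then show ?thesis by simp
    next
      case (Suc k)
      have "S (h # (b # us) @ replicate (m - 1) y) = S (b # h # us @ replicate k y)" for b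
        using Suc Suc.prems by (intro symmetric_form_perm[OF S]) auto
      then have "(\<Sum>b\<in>Basis. (y \<bullet> b) * (m * S (h # (b # us) @ replicate (m - 1) y)))
          = m * (\<Sum>b\<in>Basis. (y \<bullet> b) * S (b # h # us @ replicate k y))"
        by (simp add: sum_distrib_left algebra_simps)
      also have "(\<Sum>b\<in>Basis. (y \<bullet> b) * S (b # h # us @ replicate k y)) = S (y # h # us @ replicate k y)"
        using Suc Suc.prems by (intro symmetric_form_basis[OF S, symmetric]) auto
      also have "\<dots> = S (h # us @ replicate m y)"
        using Suc Suc.prems by (intro symmetric_form_perm[OF S]) auto
      finally show ?thesis .
    qed
    show ?thesis unfolding sum.distrib 1 2 by (simp add: algebra_simps)
  qed
  ultimately show ?case unfolding e by simp
qed

section \<open>Derivatives of powers of the norm\<close>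

text \<open>\<open>npow_deriv r i c\<close> is the \<open>i\<close>-th derivative at \<open>t = 0\<close> of \<open>\<parallel>y + t d\<parallel>\<^sup>r\<close> for unit vectors
  \<open>y\<close>, \<open>d\<close> with inner product \<open>c\<close> (a Gegenbauer polynomial, up to a constant), and
  \<open>npow_deriv' r i\<close> is its derivative in \<open>c\<close>. The defining recursion expresses differentiation along \<open>d\<close>,
  which changes both the norm and the angle.\<close>
fun npow_deriv :: "real \<Rightarrow> nat \<Rightarrow> real \<Rightarrow> real"
  and npow_deriv' :: "real \<Rightarrow> nat \<Rightarrow> real \<Rightarrow> real" where
  "npow_deriv r 0 c = 1"
| "npow_deriv' r 0 c = 0"
| "npow_deriv r (Suc i) c = (r - i) * c * npow_deriv r i c + (1 - c\<^sup>2) * npow_deriv' r i c"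
| "npow_deriv' r (Suc i) c = Suc i * ((r - i) * npow_deriv r i c - c * npow_deriv' r i c)"

text \<open>The last equation is Gegenbauer's differential equation with parameter -r/2. It has to
  be carried through the induction: differentiating the recursion produces
  \<open>(1 - c\<^sup>2) * T\<close>, which only this equation turns back into the two
  polynomials.\<close>

lemma npow_deriv_derivs:
  "(npow_deriv r i has_real_derivative npow_deriv' r i c) (at c) \<and>
   (\<exists>T. (npow_deriv' r i has_real_derivative T) (at c) \<and>
     (1 - c\<^sup>2) * T = i * (r - i) * npow_deriv r i c - (r - 1) * c * npow_deriv' r i c)"
proof (induction i)
  case 0
  have "npow_deriv r 0 = (\<lambda>_. 1)" "npow_deriv' r 0 = (\<lambda>_. 0)" by auto
  then show ?case by (auto intro!: exI[of _ 0])
next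
  case (Suc i)
  let ?P = "npow_deriv r i" and ?Q = "npow_deriv' r i"
  obtain T where P: "(?P has_real_derivative ?Q c) (at c)" and Q: "(?Q has_real_derivative T) (at c)"
    and T: "(1 - c\<^sup>2) * T = i * (r - i) * ?P c - (r - 1) * c * ?Q c"
    using Suc by blast
  have eq: "npow_deriv r (Suc i) = (\<lambda>c. (r - i) * c * ?P c + (1 - c\<^sup>2) * ?Q c)"
    "npow_deriv' r (Suc i) = (\<lambda>c. Suc i * ((r - i) * ?P c - c * ?Q c))"
    by auto
  have 1: "(npow_deriv r (Suc i) has_real_derivative
      (r - i) * ?P c + (r - i) * c * ?Q c - 2 * c * ?Q c + (1 - c\<^sup>2) * T) (at c)"
    unfolding eq by (auto intro!: derivative_eq_intros P Q simp: algebra_simps)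
  have 2: "(npow_deriv' r (Suc i) has_real_derivative Suc i * ((r - i) * ?Q c - ?Q c - c * T)) (at c)"
    unfolding eq by (auto intro!: derivative_eq_intros P Q simp: algebra_simps)
  have "(r - i) * ?P c + (r - i) * c * ?Q c - 2 * c * ?Q c + (1 - c\<^sup>2) * T = npow_deriv' r (Suc i) c"
    unfolding T by (simp add: algebra_simps)
  moreover have "(1 - c\<^sup>2) * (Suc i * ((r - i) * ?Q c - ?Q c - c * T)) =
      Suc i * (r - Suc i) * npow_deriv r (Suc i) c - (r - 1) * c * npow_deriv' r (Suc i) c"
  proof -
    have "(1 - c\<^sup>2) * (Suc i * ((r - i) * ?Q c - ?Q c - c * T)) =
      Suc i * ((1 - c\<^sup>2) * ((r - i) * ?Q c - ?Q c) - c * ((1 - c\<^sup>2) * T))"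
      by (simp add: algebra_simps)
    also have "\<dots> = Suc i * (r - Suc i) * npow_deriv r (Suc i) c - (r - 1) * c * npow_deriv' r (Suc i) c"
      unfolding T by (simp add: algebra_simps power2_eq_square)
    finally show ?thesis .
  qed
  ultimately show ?case using 1 2 by metis
qed

lemma npow_deriv_has_derivative:
  "(npow_deriv r i has_real_derivative npow_deriv' r i c) (at c)"
  using npow_deriv_derivs by blast

text \<open>At c = 1 and c = -1 the second term of the recursion drops out, and only the factors (r
  - j) c remain.\<close>

lemma npow_deriv_endpoints:
  assumes "c\<^sup>2 = 1"
  shows "\<bar>npow_deriv r i c\<bar> = (\<Prod>j<i. \<bar>r - real j\<bar>)"
proof -
  have "\<bar>c\<bar> = 1" using assms by (simp add: abs_square_eq_1)
  then show ?thesis using assms by (induction i) (auto simp: abs_mult)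
qed

lemma npow_deriv_continuous: "continuous_on A (npow_deriv r i)"
  by (rule DERIV_continuous_on[OF has_field_derivative_at_within[OF npow_deriv_has_derivative]])

text \<open>Sonin's method: \<open>F\<close> below is monotone on either side of \<open>0\<close> and agrees with the square of the
  polynomial at the endpoints and wherever the derivative vanishes.\<close>
lemma npow_deriv_le:
  assumes c: "\<bar>c\<bar> \<le> 1" and r: "real i < r"
  shows "\<bar>npow_deriv r i c\<bar> \<le> (\<Prod>j<i. (r - real j))"
proof (cases "i = 0")
  case True
  then show ?thesis by simp
next
  case i: False
  let ?P = "npow_deriv r i" and ?Q = "npow_deriv' r i"
  define R where "R = (\<Prod>j<i. (r - real j))"
  \<comment> \<open>The coefficient of the polynomial in its differential equation, positive for 0 <
    i < r; it is zero for i = 0, which was treated separately.\<close>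
  define A where "A = i * (r - i)"
  have A: "0 < A" using i r by (simp add: A_def)
  have R: "\<bar>?P u\<bar> = R" if "u\<^sup>2 = 1" for u
    unfolding npow_deriv_endpoints[OF that] R_def using r by (intro prod.cong) auto
  have R2: "(?P u)\<^sup>2 = R\<^sup>2" if "u\<^sup>2 = 1" for u
    using R[OF that] by (metis power2_abs)
  define F where "F u = (?P u)\<^sup>2 - (1 - u\<^sup>2) * (?Q u)\<^sup>2 / A" for u
  \<comment> \<open>By the differential equation the products of \<open>?P\<close> and
    \<open>?Q\<close> cancel, and 2 u + 2 (r - 1) u = 2 r u remains; so the derivative has the sign
    of u.\<close>
  have dF: "(F has_real_derivative 2 * r * u * (?Q u)\<^sup>2 / A) (at u)" for u
  proof -
    obtain T where Q: "(?Q has_real_derivative T) (at u)"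
      and T: "(1 - u\<^sup>2) * T = A * ?P u - (r - 1) * u * ?Q u"
      using npow_deriv_derivs[of r i u] unfolding A_def by blast
    have "(F has_real_derivative 2 * ?P u * ?Q u + 2 * u * (?Q u)\<^sup>2 / A - 2 * ?Q u * ((1 - u\<^sup>2) * T) / A) (at u)"
      unfolding F_def using A
      by (auto intro!: derivative_eq_intros npow_deriv_has_derivative Q simp: field_simps power2_eq_square)
    also have "2 * ?P u * ?Q u + 2 * u * (?Q u)\<^sup>2 / A - 2 * ?Q u * ((1 - u\<^sup>2) * T) / A = 2 * r * u * (?Q u)\<^sup>2 / A"
      unfolding T using A by (simp add: field_simps power2_eq_square)
    finally show ?thesis .
  qed
  have "continuous_on {-1..1} (\<lambda>u. (?P u)\<^sup>2)"
    by (intro continuous_intros npow_deriv_continuous)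
  then obtain m where m: "m \<in> {-1..1}" "\<And>u. u \<in> {-1..1} \<Longrightarrow> (?P u)\<^sup>2 \<le> (?P m)\<^sup>2"
    using continuous_attains_sup[of "{-1..1::real}" "\<lambda>u. (?P u)\<^sup>2"] by force
  have "(?P m)\<^sup>2 \<le> R\<^sup>2"
  proof (cases "m\<^sup>2 = 1")
    case True
    then show ?thesis using R2[of m] by simp
  next
    case False
    then have m1: "-1 < m" "m < 1" using m(1) by (auto simp: less_le power2_eq_1_iff)
    have "((\<lambda>u. (?P u)\<^sup>2) has_real_derivative 2 * ?P m * ?Q m) (at m)"
      by (auto intro!: derivative_eq_intros npow_deriv_has_derivative)
    moreover have "\<forall>u. \<bar>m - u\<bar> < min (m + 1) (1 - m) \<longrightarrow> (?P u)\<^sup>2 \<le> (?P m)\<^sup>2"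
      using m(2) by (auto simp: abs_less_iff)
    ultimately have "2 * ?P m * ?Q m = 0"
      using m1 by (intro DERIV_local_max[of "\<lambda>u. (?P u)\<^sup>2" _ m "min (m + 1) (1 - m)"]) auto
    then consider "?P m = 0" | "?Q m = 0" by auto
    then show ?thesis
    proof cases
      case 1
      then show ?thesis by simp
    next
      case 2
      then have "(?P m)\<^sup>2 = F m" by (simp add: F_def)
      also have "F m \<le> R\<^sup>2"
      proof (cases "0 \<le> m")
        case True
        have "F m \<le> F 1"
        proof (rule DERIV_nonneg_imp_nondecreasing[where f = F])
          show "\<exists>y. (F has_real_derivative y) (at u) \<and> 0 \<le> y" if "m \<le> u" for u
            using that True A r
            by (intro exI[of _ "2 * r * u * (?Q u)\<^sup>2 / A"] conjI dF divide_nonneg_pos mult_nonneg_nonneg) auto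
        qed (use m1 in simp)
        also have "\<dots> = R\<^sup>2" using R2[of 1] by (simp add: F_def)
        finally show ?thesis .
      next
        case False
        have "F m \<le> F (-1)"
        proof (rule DERIV_nonpos_imp_nonincreasing[where f = F])
          show "\<exists>y. (F has_real_derivative y) (at u) \<and> y \<le> 0" if "u \<le> m" for u
            using that False A r
            by (intro exI[of _ "2 * r * u * (?Q u)\<^sup>2 / A"] conjI dF divide_nonpos_pos mult_nonpos_nonneg mult_nonneg_nonpos) auto
        qed (use m1 in simp)
        also have "\<dots> = R\<^sup>2" using R2[of "-1"] by (simp add: F_def)
        finally show ?thesis .
      qed
      finally show ?thesis .
    qed
  qed
  moreover have "(?P c)\<^sup>2 \<le> (?P m)\<^sup>2" using c by (intro m(2)) auto
  moreover have "0 \<le> R" unfolding R_def using r by (intro prod_nonneg) auto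
  ultimately show ?thesis unfolding R_def[symmetric] by (metis abs_le_square_iff abs_of_nonneg order_trans)
qed

text \<open>The i-th derivative of the r-th power of the norm at \<open>y\<close> along
  \<open>d\<close>, extended from unit vectors by homogeneity. For d = 0 the angle is 0 by division
  by zero, and \<open>norm d ^ i\<close> supplies the right value.\<close>

definition npow_form :: "real \<Rightarrow> nat \<Rightarrow> 'a::euclidean_space \<Rightarrow> 'a \<Rightarrow> real" where
  "npow_form r i d y = norm y powr (r - i) * norm d ^ i * npow_deriv r i ((y \<bullet> d) / (norm y * norm d))"

lemma npow_form_0: "npow_form r 0 d y = norm y powr r"
  by (simp add: npow_form_def)

lemma norm_powr_has_derivative:
  fixes y :: "'a::euclidean_space"
  assumes "y \<noteq> 0"
  shows "((\<lambda>y. norm y powr a) has_derivative (\<lambda>h. a * norm y powr (a - 1) * (sgn y \<bullet> h))) (at y)"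
proof -
  have "(norm has_derivative (\<lambda>h. sgn y \<bullet> h)) (at y)"
    using has_derivative_norm[OF assms] by (simp add: inner_commute)
  from has_derivative_compose[OF this has_real_derivative_powr[of "norm y" a, unfolded has_field_derivative_def]]
  show ?thesis using assms by simp
qed

text \<open>This is the origin of the recursion for \<open>npow_deriv\<close>: along
  \<open>d\<close>, the norm of y grows at the rate \<kappa> |d| and the cosine \<kappa> at the rate
  |d| (1 - \<kappa>^2) / |y|.\<close>

lemma npow_form_has_derivative:
  fixes y d :: "'a::euclidean_space"
  assumes "y \<noteq> 0"
  shows "\<exists>D. (npow_form r i d has_derivative D) (at y) \<and> D d = npow_form r (Suc i) d y"
proof (cases "d = 0")
  case True
  have "npow_form r i d = (\<lambda>y. norm y powr (r - i) * (0 ^ i * npow_deriv r i 0))"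
    using True by (auto simp: npow_form_def)
  moreover have "((\<lambda>y. norm y powr (r - i) * (0 ^ i * npow_deriv r i 0)) has_derivative
      (\<lambda>h. ((r - i) * norm y powr (r - i - 1) * (sgn y \<bullet> h)) * (0 ^ i * npow_deriv r i 0))) (at y)"
    by (intro has_derivative_mult_left norm_powr_has_derivative assms)
  ultimately show ?thesis using True by (auto simp: npow_form_def intro!: exI)
next
  case d: False
  define \<kappa> where "\<kappa> y = (y \<bullet> d) / (norm y * norm d)" for y
  define K where "K h = ((h \<bullet> d) * norm y - (y \<bullet> d) * (sgn y \<bullet> h)) / ((norm y)\<^sup>2 * norm d)" for h
  have ny: "0 < norm y" "0 < norm d" using assms d by auto
  have dk: "(\<kappa> has_derivative K) (at y)"
  proof -
    have "((\<lambda>y. (y \<bullet> d) / (norm y * norm d)) has_derivative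
      (\<lambda>h. ((h \<bullet> d) * (norm y * norm d) - (y \<bullet> d) * ((sgn y \<bullet> h) * norm d)) / (norm y * norm d * (norm y * norm d)))) (at y)"
    proof (intro has_derivative_divide' has_derivative_inner_left has_derivative_mult_left has_derivative_ident)
      show "(norm has_derivative (\<lambda>h. sgn y \<bullet> h)) (at y)"
        using has_derivative_norm[OF assms] by (simp add: inner_commute)
    qed (use ny in simp)
    moreover have "((h \<bullet> d) * (norm y * norm d) - (y \<bullet> d) * ((sgn y \<bullet> h) * norm d)) / (norm y * norm d * (norm y * norm d)) = K h" for h
      unfolding K_def using ny by (simp add: field_simps power2_eq_square)
    ultimately show ?thesis unfolding \<kappa>_def by simp
  qed
  have dP: "((\<lambda>y. npow_deriv r i (\<kappa> y)) has_derivative (\<lambda>h. npow_deriv' r i (\<kappa> y) * K h)) (at y)"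
    using has_derivative_compose[OF dk npow_deriv_has_derivative[of r i "\<kappa> y", unfolded has_field_derivative_def]]
    by simp
  have dn: "((\<lambda>y. norm y powr (r - i)) has_derivative (\<lambda>h. (r - i) * norm y powr (r - i - 1) * (sgn y \<bullet> h))) (at y)"
    by (intro norm_powr_has_derivative assms)
  let ?D = "\<lambda>h. norm d ^ i * (norm y powr (r - i) * (npow_deriv' r i (\<kappa> y) * K h) +
    (r - i) * norm y powr (r - i - 1) * (sgn y \<bullet> h) * npow_deriv r i (\<kappa> y))"
  have "((\<lambda>y. norm d ^ i * (norm y powr (r - i) * npow_deriv r i (\<kappa> y))) has_derivative ?D) (at y)"
    by (intro has_derivative_mult_right has_derivative_mult dn dP)
  moreover have "(\<lambda>y. norm d ^ i * (norm y powr (r - i) * npow_deriv r i (\<kappa> y))) = npow_form r i d"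
    by (auto simp: npow_form_def \<kappa>_def)
  moreover have "?D d = npow_form r (Suc i) d y"
  proof -
    have yd: "y \<bullet> d = \<kappa> y * norm y * norm d" using ny by (simp add: \<kappa>_def)
    have s: "sgn y \<bullet> d = \<kappa> y * norm d" using ny by (simp add: sgn_div_norm yd)
    have k: "K d = norm d * (1 - (\<kappa> y)\<^sup>2) / norm y"
      unfolding K_def s yd using ny by (simp add: field_simps power2_eq_square flip: power2_norm_eq_inner)
    have p: "norm y powr (r - i) = norm y * norm y powr (r - i - 1)"
      using ny by (simp add: powr_diff)
    have "npow_form r (Suc i) d y = norm y powr (r - i - 1) * (norm d * norm d ^ i) * npow_deriv r (Suc i) (\<kappa> y)"
      by (simp add: npow_form_def \<kappa>_def algebra_simps)
    moreover have "norm y * X * (Q * (norm d * u / norm y)) = X * (Q * (norm d * u))" for X Q u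
      using ny by simp
    ultimately have "npow_form r (Suc i) d y = norm d ^ i * (norm y powr (r - i) * (npow_deriv' r i (\<kappa> y) * K d) +
      (r - i) * norm y powr (r - i - 1) * (\<kappa> y * norm d) * npow_deriv r i (\<kappa> y))"
      unfolding k p by (simp only: npow_deriv.simps) (simp only: algebra_simps)
    then show ?thesis unfolding s by simp
  qed
  ultimately show ?thesis by (intro exI[of _ ?D]) simp
qed

lemma abs_angle_le: "\<bar>(y \<bullet> d) / (norm y * norm d)\<bar> \<le> 1"
  using Cauchy_Schwarz_ineq2[of y d] unfolding abs_divide abs_mult abs_norm_cancel
  by (intro divide_le_eq_1[THEN iffD2]) auto

lemma npow_form_le:
  assumes "real i < r"
  shows "\<bar>npow_form r i d y\<bar> \<le> (\<Prod>j<i. (r - real j)) * norm y powr (r - i) * norm d ^ i"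
proof -
  have "\<bar>npow_form r i d y\<bar> = norm y powr (r - i) * norm d ^ i * \<bar>npow_deriv r i ((y \<bullet> d) / (norm y * norm d))\<bar>"
    by (simp add: npow_form_def abs_mult)
  also have "\<dots> \<le> norm y powr (r - i) * norm d ^ i * (\<Prod>j<i. (r - real j))"
    by (intro mult_left_mono npow_deriv_le abs_angle_le assms) auto
  finally show ?thesis by (simp add: algebra_simps)
qed

text \<open>The sharp bound requires i < r, but the Taylor remainder of the model has order q + 1,
  possibly p + 1 \<ge> p + \<beta>. Any constant suffices there.\<close>

lemma npow_form_bounded:
  obtains C where "0 \<le> C" "\<And>d y. \<bar>npow_form r i d y\<bar> \<le> C * norm y powr (r - i) * norm d ^ i"
proof -
  have "continuous_on {-1..1} (\<lambda>c. \<bar>npow_deriv r i c\<bar>)"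
    by (intro continuous_intros npow_deriv_continuous)
  then obtain m where m: "\<And>u. u \<in> {-1..1} \<Longrightarrow> \<bar>npow_deriv r i u\<bar> \<le> \<bar>npow_deriv r i m\<bar>"
    using continuous_attains_sup[of "{-1..1::real}" "\<lambda>u. \<bar>npow_deriv r i u\<bar>"] by force
  have "\<bar>npow_form r i d y\<bar> \<le> \<bar>npow_deriv r i m\<bar> * norm y powr (r - i) * norm d ^ i" for d y :: 'a
  proof -
    have "\<bar>npow_form r i d y\<bar> = norm y powr (r - i) * norm d ^ i * \<bar>npow_deriv r i ((y \<bullet> d) / (norm y * norm d))\<bar>"
      by (simp add: npow_form_def abs_mult)
    also have "\<dots> \<le> norm y powr (r - i) * norm d ^ i * \<bar>npow_deriv r i m\<bar>"
    proof -
      have "a \<in> {-1..1}" if "\<bar>a\<bar> \<le> 1" for a :: real using that by (simp add: abs_le_iff)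
      from this[OF abs_angle_le[of y d]] show ?thesis
        by (intro mult_left_mono m mult_nonneg_nonneg) simp_all
    qed
    finally show ?thesis by (simp add: algebra_simps)
  qed
  then show ?thesis using that[of "\<bar>npow_deriv r i m\<bar>"] by simp
qed

section \<open>Taylor's theorem with Hoelder remainder\<close>

lemma gfact_0 [simp]: "gfact 0 \<beta> = 1"
  by (simp add: gfact_def)

lemma gfact_Suc: "gfact (Suc k) \<beta> = gfact k \<beta> * (\<beta> + Suc k)"
  by (simp add: gfact_def)

lemma gfact_pos: "0 < \<beta> \<Longrightarrow> 0 < gfact k \<beta>"
  by (auto simp: gfact_def intro!: prod_pos)

lemma gfact_mono:
  assumes "0 < \<beta>" "k \<le> l"
  shows "gfact k \<beta> \<le> gfact l \<beta>"
  using assms(2)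
proof (induction l rule: dec_induct)
  case base
  then show ?case by simp
next
  case (step l)
  have "gfact l \<beta> * 1 \<le> gfact l \<beta> * (\<beta> + Suc l)"
    using assms(1) gfact_pos[of \<beta> l] by (intro mult_left_mono) auto
  with step show ?case by (simp add: gfact_Suc)
qed

lemma gfact_falling:
  assumes "0 < \<beta>"
  shows "i \<le> p \<Longrightarrow> (\<Prod>j<i. (real p + \<beta> - real j)) * gfact (p - i) \<beta> = gfact p \<beta>"
proof (induction i)
  case 0
  then show ?case by simp
next
  case (Suc i)
  have "p - i = Suc (p - Suc i)" using Suc.prems by simp
  then have "gfact (p - i) \<beta> = gfact (p - Suc i) \<beta> * (real p + \<beta> - real i)"
    using Suc.prems by (simp add: gfact_Suc of_nat_diff)
  with Suc show ?case by (simp add: mult_ac)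
qed

lemma powr_continuous_on_nonneg: "0 < a \<Longrightarrow> continuous_on {0..b} (\<lambda>t::real. t powr a)"
  by (intro continuous_on_powr' continuous_intros) auto

text \<open>The bound for the first derivative is integrated; integrating the power m + \<beta>
  divides by m + 1 + \<beta>, and these divisors build up \<open>gfact\<close>.\<close>

lemma holder_taylor_1d:
  fixes h :: "nat \<Rightarrow> real \<Rightarrow> real"
  assumes "0 < \<beta>" "\<And>k t. k < m \<Longrightarrow> (h k has_real_derivative h (Suc k) t) (at t)"
    and "\<And>t. 0 \<le> t \<Longrightarrow> t \<le> 1 \<Longrightarrow> \<bar>h m t - h m 0\<bar> \<le> C * t powr \<beta>"
    and "0 \<le> t" "t \<le> 1"
  shows "\<bar>h 0 t - (\<Sum>k\<le>m. h k 0 * t ^ k / fact k)\<bar> \<le> C * t powr (real m + \<beta>) / gfact m \<beta>"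
  using assms(2-)
proof (induction m arbitrary: h t)
  case 0
  then show ?case by simp
next
  case (Suc m)
  define P where "P t = (\<Sum>k\<le>Suc m. h k 0 * t ^ k / fact k)" for t
  define Q where "Q t = (\<Sum>k\<le>m. h (Suc k) 0 * t ^ k / fact k)" for t
  define W where "W t = C * t powr (real (Suc m) + \<beta>) / gfact (Suc m) \<beta>" for t
  have IH: "\<bar>h 1 t - Q t\<bar> \<le> C * t powr (real m + \<beta>) / gfact m \<beta>" if "0 \<le> t" "t \<le> 1" for t
    using Suc.IH[of "\<lambda>k. h (Suc k)" t] Suc.prems(1,2) that unfolding Q_def by simp
  have dP: "(P has_real_derivative Q t) (at t)" for t
  proof -
    have pow: "((\<lambda>t. t ^ Suc n) has_real_derivative real (Suc n) * t ^ n) (at t)" for n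
      using DERIV_pow[of "Suc n" t UNIV] by simp
    have "((\<lambda>t. h 0 0 + (\<Sum>k\<le>m. h (Suc k) 0 * t ^ Suc k / fact (Suc k))) has_real_derivative
      (0 + (\<Sum>k\<le>m. h (Suc k) 0 * (real (Suc k) * t ^ k) / fact (Suc k)))) (at t)"
      by (intro DERIV_add DERIV_const DERIV_sum DERIV_cdivide DERIV_cmult pow)
    moreover have "P = (\<lambda>t. h 0 0 + (\<Sum>k\<le>m. h (Suc k) 0 * t ^ Suc k / fact (Suc k)))"
      by (rule ext) (simp only: P_def sum.atMost_Suc_shift, simp)
    moreover have "h (Suc k) 0 * (real (Suc k) * t ^ k) / fact (Suc k) = h (Suc k) 0 * t ^ k / fact k" for k
      by (simp only: fact_Suc) (simp del: of_nat_Suc)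
    ultimately show ?thesis by (simp add: Q_def)
  qed
  have dW: "(W has_real_derivative C * t powr (real m + \<beta>) / gfact m \<beta>) (at t)" if "0 < t" for t
  proof -
    have "(W has_real_derivative C * ((real (Suc m) + \<beta>) * t powr (real (Suc m) + \<beta> - 1)) / gfact (Suc m) \<beta>) (at t)"
      unfolding W_def by (intro DERIV_cdivide DERIV_cmult has_real_derivative_powr that)
    moreover have "real (Suc m) + \<beta> \<noteq> 0" using assms(1) by auto
    then have "C * ((real (Suc m) + \<beta>) * t powr (real (Suc m) + \<beta> - 1)) / gfact (Suc m) \<beta> = C * t powr (real m + \<beta>) / gfact m \<beta>"
      by (simp add: gfact_Suc add.commute[of \<beta>])
    ultimately show ?thesis by simp
  qed
  have dh: "(h 0 has_real_derivative h 1 t) (at t)" for t using Suc.prems(1)[of 0] by simp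
  have "continuous_on {0..t} (\<lambda>t. C / gfact (Suc m) \<beta> * t powr (real (Suc m) + \<beta>))"
    using assms(1) by (intro continuous_on_mult_left powr_continuous_on_nonneg) simp
  then have contW: "continuous_on {0..t} W" by (simp add: W_def)
  have conth: "continuous_on {0..t} (h 0)" "continuous_on {0..t} P"
    by (rule DERIV_continuous_on, rule has_field_derivative_at_within, rule dh dP)+
  have W0: "W 0 = 0" using assms(1) by (simp add: W_def)
  have P0: "P 0 = h 0 0" by (simp only: P_def sum.atMost_Suc_shift) simp
  \<comment> \<open>The sign \<open>c\<close> gives both halves of the absolute value. Derivatives
    are compared on the open interval because \<open>powr\<close> is differentiated at positive
    arguments only; continuity covers the endpoints.\<close>
  have bound: "c * (h 0 t - P t) \<le> W t" if c: "\<bar>c\<bar> = 1" for c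
  proof -
    have "W 0 - c * (h 0 0 - P 0) \<le> W t - c * (h 0 t - P t)"
    proof (rule DERIV_nonneg_imp_increasing_open[where f = "\<lambda>t. W t - c * (h 0 t - P t)"])
      fix u assume u: "0 < u" "u < t"
      have "((\<lambda>t. W t - c * (h 0 t - P t)) has_real_derivative
          C * u powr (real m + \<beta>) / gfact m \<beta> - c * (h 1 u - Q u)) (at u)"
        by (intro DERIV_diff DERIV_cmult dW dP dh u)
      moreover have "c * (h 1 u - Q u) \<le> C * u powr (real m + \<beta>) / gfact m \<beta>"
      proof -
        have "c * (h 1 u - Q u) \<le> \<bar>c * (h 1 u - Q u)\<bar>" by (rule abs_ge_self)
        also have "\<dots> = \<bar>h 1 u - Q u\<bar>" using c by (simp add: abs_mult)
        also have "\<dots> \<le> C * u powr (real m + \<beta>) / gfact m \<beta>"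
          using u Suc.prems(4) by (intro IH) auto
        finally show ?thesis .
      qed
      ultimately show "\<exists>y. ((\<lambda>t. W t - c * (h 0 t - P t)) has_real_derivative y) (at u) \<and> 0 \<le> y"
        by (metis diff_ge_0_iff_ge)
    qed (intro Suc.prems continuous_on_diff continuous_on_mult_left contW conth)+
    then show ?thesis by (simp add: W0 P0)
  qed
  have "\<bar>h 0 t - P t\<bar> \<le> W t" using bound[of 1] bound[of "-1"] by (simp add: abs_le_iff)
  then show ?case by (simp only: P_def W_def)
qed

section \<open>Mixed Hoelder bounds, and derivatives of the Taylor polynomial and the model\<close>

lemma tensor_norm_bound:
  fixes S :: "'a::euclidean_space list \<Rightarrow> real"
  assumes S: "symmetric_form n S"
  shows "\<bar>S (replicate n v)\<bar> \<le> tensor_norm n S * norm v ^ n"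
proof -
  obtain C where C: "\<And>vs. length vs = n \<Longrightarrow> \<bar>S vs\<bar> \<le> C * prod_list (map norm vs)"
    using symmetric_form_bounded[OF S] by blast
  have bdd: "bdd_above ((\<lambda>v. \<bar>S (replicate n v)\<bar>) ` sphere 0 1)"
  proof (rule bdd_aboveI2)
    show "\<bar>S (replicate n v)\<bar> \<le> C" if "v \<in> sphere 0 1" for v
      using C[of "replicate n v"] that by simp
  qed
  obtain e :: 'a where e: "norm e = 1" using vector_choose_size[of 1] by auto
  define u where "u = (if v = 0 then e else (1 / norm v) *\<^sub>R v)"
  have u: "norm u = 1" "v = norm v *\<^sub>R u" using e by (auto simp: u_def)
  have "S (replicate n v) = norm v ^ n * S (replicate n u)"
    using symmetric_form_replicate_scaleR[OF S, of "[]" n "norm v" u, folded u(2)] by simp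
  then have "\<bar>S (replicate n v)\<bar> = \<bar>S (replicate n u)\<bar> * norm v ^ n" by (simp add: abs_mult)
  also have "\<bar>S (replicate n u)\<bar> \<le> tensor_norm n S"
    unfolding tensor_norm_def using u by (intro cSUP_upper[OF _ bdd]) simp
  finally show ?thesis by (simp add: mult_right_mono)
qed

text \<open>Banach's theorem removes the restriction to the diagonal without changing
  \<open>L\<close>.\<close>

lemma holder_nabla_diff:
  assumes f: "holder_class p \<beta> f f_low L" and l: "length vs = p"
  shows "\<bar>nabla f vs x - nabla f vs y\<bar> \<le> L * norm (x - y) powr \<beta> * prod_list (map norm vs)"
proof -
  let ?S = "\<lambda>vs. nabla f vs x - nabla f vs y"
  have cd: "cont_differentiable p f" and L: "0 \<le> L"
    and tn: "tensor_norm p ?S \<le> L * norm (x - y) powr \<beta>"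
    using f unfolding holder_class_def by blast+
  have S: "symmetric_form p ?S"
    by (intro symmetric_form_diff nabla_symmetric_form[OF cd]) auto
  show ?thesis
  proof (rule symmetric_form_diagonal_bound[OF S _ _ l])
    fix v
    have "\<bar>?S (replicate p v)\<bar> \<le> tensor_norm p ?S * norm v ^ p" by (rule tensor_norm_bound[OF S])
    also have "\<dots> \<le> L * norm (x - y) powr \<beta> * norm v ^ p" by (intro mult_right_mono tn) simp
    finally show "\<bar>?S (replicate p v)\<bar> \<le> L * norm (x - y) powr \<beta> * norm v ^ p" .
  qed (use L in simp)
qed

text \<open>The \<open>i\<close>-th derivative of \<open>taylor f p x\<close> at \<open>y\<close> in direction \<open>d\<close>; it vanishes for \<open>i > p\<close>.\<close>
definition taylor_deriv ::
    "('a::euclidean_space \<Rightarrow> real) \<Rightarrow> nat \<Rightarrow> 'a \<Rightarrow> nat \<Rightarrow> 'a \<Rightarrow> 'a \<Rightarrow> real" where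
  "taylor_deriv f p x i d y =
     (\<Sum>m<Suc p - i. 1 / fact m * nabla f (replicate i d @ replicate m y) x)"

lemma taylor_deriv_0: "taylor_deriv f p x 0 d = taylor f p x"
proof
  fix s
  have "{..<Suc p} = insert 0 {1..p}" by auto
  then show "taylor_deriv f p x 0 d s = taylor f p x s" by (simp add: taylor_deriv_def taylor_def)
qed

text \<open>The term m = 0 disappears and m / m! = 1 / (m - 1)!, which shifts the sum. Fixing the
  derivative's value along \<open>d\<close> only is what \<open>nabla_replicate_eq\<close> asks
  for.\<close>

lemma taylor_deriv_has_derivative:
  assumes f: "cont_differentiable p f"
  shows "\<exists>D. (taylor_deriv f p x i d has_derivative D) (at y) \<and> D d = taylor_deriv f p x (Suc i) d y"
proof -
  let ?D = "\<lambda>h. \<Sum>m<Suc p - i. 1 / fact m * (real m * nabla f (h # replicate i d @ replicate (m - 1) y) x)"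
  have "((\<lambda>y. \<Sum>m<Suc p - i. 1 / fact m * nabla f (replicate i d @ replicate m y) x) has_derivative ?D) (at y)"
  proof (intro has_derivative_sum has_derivative_mult_right)
    fix m assume "m \<in> {..<Suc p - i}"
    then show "((\<lambda>y. nabla f (replicate i d @ replicate m y) x) has_derivative
        (\<lambda>h. real m * nabla f (h # replicate i d @ replicate (m - 1) y) x)) (at y)"
      by (intro symmetric_form_has_derivative[OF nabla_symmetric_form[OF f, of "i + m"]]) auto
  qed
  moreover have "?D d = taylor_deriv f p x (Suc i) d y"
  proof (cases "i \<le> p")
    case True
    then have "Suc p - i = Suc (Suc p - Suc i)" by simp
    then have "?D d = (\<Sum>m<Suc p - Suc i. 1 / fact (Suc m) * (real (Suc m) * nabla f (d # replicate i d @ replicate m y) x))"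
      by (simp only: sum.lessThan_Suc_shift) simp
    also have "\<dots> = taylor_deriv f p x (Suc i) d y"
      unfolding taylor_deriv_def
      by (intro sum.cong refl) (simp only: fact_Suc replicate_Suc append_Cons, simp del: of_nat_Suc nabla.simps)
    finally show ?thesis .
  qed (simp add: taylor_deriv_def)
  moreover have "(\<lambda>y. \<Sum>m<Suc p - i. 1 / fact m * nabla f (replicate i d @ replicate m y) x) = taylor_deriv f p x i d"
    by (auto simp: taylor_deriv_def)
  ultimately show ?thesis by (intro exI[of _ ?D]) simp
qed

text \<open>Uniqueness of the derivative identifies the value of \<open>frechet_derivative\<close>;
  the equality is kept on an open set because it must survive the next differentiation.\<close>

lemma nabla_replicate_eq:
  assumes U: "open U"
    and E: "\<And>i y. y \<in> U \<Longrightarrow> \<exists>D. (E i has_derivative D) (at y) \<and> D d = E (Suc i) y"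
    and g: "\<And>y. y \<in> U \<Longrightarrow> g y = E 0 y"
  shows "y \<in> U \<Longrightarrow> nabla g (replicate i d) y = E i y"
proof (induction i arbitrary: y)
  case 0
  then show ?case by (simp add: g)
next
  case (Suc i)
  obtain D where D: "(E i has_derivative D) (at y)" "D d = E (Suc i) y" using E[OF Suc.prems] by blast
  have "(nabla g (replicate i d) has_derivative D) (at y)"
    using has_derivative_transform_within_open[OF D(1) U Suc.prems] Suc.IH by metis
  then have "frechet_derivative (nabla g (replicate i d)) (at y) = D"
    by (rule frechet_derivative_at[symmetric])
  then show ?case using D(2) by simp
qed

theorem nabla_taylor_error:
  assumes f: "holder_class p \<beta> f f_low L" and \<beta>: "0 < \<beta>" and j: "j \<le> p"
  shows "\<bar>nabla f (replicate j d) (x + s) - taylor_deriv f p x j d s\<bar>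
    \<le> L / gfact (p - j) \<beta> * norm s powr (real (p - j) + \<beta>) * norm d ^ j"
proof -
  have cd: "cont_differentiable p f" using f unfolding holder_class_def by blast
  define m where "m = p - j"
  \<comment> \<open>The j-th derivative along \<open>d\<close>, restricted to the segment; m = p - j
    further derivatives along \<open>s\<close> reach order p, where the mixed Hoelder bound
    applies.\<close>
  define h where "h k t = nabla f (replicate k s @ replicate j d) (x + t *\<^sub>R s)" for k t
  define C where "C = L * norm s powr \<beta> * (norm s ^ m * norm d ^ j)"
  have "\<bar>h 0 1 - (\<Sum>k\<le>m. h k 0 * 1 ^ k / fact k)\<bar> \<le> C * 1 powr (real m + \<beta>) / gfact m \<beta>"
  proof (rule holder_taylor_1d[OF \<beta>])
    fix k t assume "k < m"
    then have "((\<lambda>t. nabla f (replicate k s @ replicate j d) (x + t *\<^sub>R s)) has_real_derivative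
        nabla f (s # replicate k s @ replicate j d) (x + t *\<^sub>R s)) (at t)"
      by (intro nabla_line_derivative[OF cd]) (simp add: m_def)
    then show "(h k has_real_derivative h (Suc k) t) (at t)"
      unfolding h_def by simp
  next
    fix t :: real assume t: "0 \<le> t" "t \<le> 1"
    have "\<bar>h m t - h m 0\<bar> \<le> L * norm ((x + t *\<^sub>R s) - (x + 0 *\<^sub>R s)) powr \<beta> * prod_list (map norm (replicate m s @ replicate j d))"
      unfolding h_def using j by (intro holder_nabla_diff[OF f]) (simp add: m_def)
    also have "\<dots> = C * t powr \<beta>" using t by (simp add: C_def powr_mult)
    finally show "\<bar>h m t - h m 0\<bar> \<le> C * t powr \<beta>" .
  qed auto
  moreover have "h 0 1 = nabla f (replicate j d) (x + s)" by (simp add: h_def)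
  moreover have "(\<Sum>k\<le>m. h k 0 * 1 ^ k / fact k) = taylor_deriv f p x j d s"
    unfolding taylor_deriv_def
  proof (rule sum.cong)
    show "{..m} = {..<Suc p - j}" using j by (auto simp: m_def)
    fix k assume "k \<in> {..<Suc p - j}"
    then have "nabla f (replicate k s @ replicate j d) = nabla f (replicate j d @ replicate k s)"
      by (intro nabla_perm[OF cd]) auto
    then show "h k 0 * 1 ^ k / fact k = 1 / fact k * nabla f (replicate j d @ replicate k s) x"
      by (simp add: h_def)
  qed
  moreover have "C = L * norm s powr (real m + \<beta>) * norm d ^ j"
  proof -
    have "norm s powr \<beta> * norm s ^ m = norm s powr (real m + \<beta>)"
      using \<beta> by (cases "s = 0") (simp_all add: powr_add powr_realpow)
    then show ?thesis unfolding C_def by (metis mult.assoc)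
  qed
  ultimately show ?thesis by (simp add: m_def)
qed

lemma nabla_model_eq:
  assumes f: "cont_differentiable p f" and y: "y \<noteq> 0"
  shows "nabla (model f p \<beta> x \<sigma>) (replicate i d) y =
    taylor_deriv f p x i d y + \<sigma> / gfact p \<beta> * npow_form (real p + \<beta>) i d y"
proof (rule nabla_replicate_eq[where U = "- {0}" and
      E = "\<lambda>i y. taylor_deriv f p x i d y + \<sigma> / gfact p \<beta> * npow_form (real p + \<beta>) i d y"])
  fix i and y :: 'a assume "y \<in> - {0}"
  then obtain D1 D2 where D: "(taylor_deriv f p x i d has_derivative D1) (at y)" "D1 d = taylor_deriv f p x (Suc i) d y"
    "(npow_form (real p + \<beta>) i d has_derivative D2) (at y)" "D2 d = npow_form (real p + \<beta>) (Suc i) d y"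
    using taylor_deriv_has_derivative[OF f, of x i d y] npow_form_has_derivative[of y "real p + \<beta>" i d] by auto
  show "\<exists>D. ((\<lambda>y. taylor_deriv f p x i d y + \<sigma> / gfact p \<beta> * npow_form (real p + \<beta>) i d y) has_derivative D) (at y) \<and>
      D d = taylor_deriv f p x (Suc i) d y + \<sigma> / gfact p \<beta> * npow_form (real p + \<beta>) (Suc i) d y"
    by (intro exI[of _ "\<lambda>h. D1 h + \<sigma> / gfact p \<beta> * D2 h"] conjI has_derivative_add has_derivative_mult_right D)
      (simp add: D)
qed (use y in \<open>auto simp: model_def taylor_deriv_0 npow_form_0\<close>)

section \<open>Criticality measures of the objective and of the model\<close>

lemma nabla_replicate_bounded:
  assumes f: "cont_differentiable p f"
  obtains C where "\<And>l. 0 \<le> C l" "\<And>l m d y. l + m \<le> p \<Longrightarrow> \<bar>nabla f (replicate l d @ replicate m y) x\<bar> \<le> C (l + m) * norm d ^ l * norm y ^ m"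
proof -
  have "\<exists>C\<ge>0. \<forall>vs. n \<le> p \<longrightarrow> length vs = n \<longrightarrow> \<bar>nabla f vs x\<bar> \<le> C * prod_list (map norm vs)" for n
  proof (cases "n \<le> p")
    case True
    show ?thesis using symmetric_form_bounded[OF nabla_symmetric_form[OF f True, of x]] by metis
  qed auto
  then obtain C where C: "\<And>n. 0 \<le> C n" "\<And>n vs. n \<le> p \<Longrightarrow> length vs = n \<Longrightarrow> \<bar>nabla f vs x\<bar> \<le> C n * prod_list (map norm vs)"
    by metis
  have "\<bar>nabla f (replicate l d @ replicate m y) x\<bar> \<le> C (l + m) * norm d ^ l * norm y ^ m" if "l + m \<le> p" for l m d y
    using C(2)[OF that, of "replicate l d @ replicate m y"] by (simp add: mult.assoc)
  with C(1) show ?thesis using that by blast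
qed

lemma nabla_model_error:
  assumes f: "holder_class p \<beta> f f_low L" and \<beta>: "0 < \<beta>" and j: "j \<le> p"
    and s: "s \<noteq> 0" and \<sigma>: "0 \<le> \<sigma>"
  shows "\<bar>nabla f (replicate j d) (x + s) - nabla (model f p \<beta> x \<sigma>) (replicate j d) s\<bar>
    \<le> (L + \<sigma>) / gfact (p - j) \<beta> * norm s powr (real (p - j) + \<beta>) * norm d ^ j"
proof -
  have cd: "cont_differentiable p f" using f unfolding holder_class_def by blast
  let ?n = "norm s powr (real (p - j) + \<beta>) * norm d ^ j"
  have g: "0 < gfact p \<beta>" "0 < gfact (p - j) \<beta>" using gfact_pos[OF \<beta>] by auto
  have "\<bar>npow_form (real p + \<beta>) j d s\<bar> \<le> (\<Prod>i<j. (real p + \<beta> - real i)) * norm s powr (real p + \<beta> - real j) * norm d ^ j"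
    using j \<beta> by (intro npow_form_le) simp
  also have "(\<Prod>i<j. (real p + \<beta> - real i)) = gfact p \<beta> / gfact (p - j) \<beta>"
    using gfact_falling[OF \<beta> j] g by (simp add: field_simps)
  also have "real p + \<beta> - real j = real (p - j) + \<beta>" using j by simp
  finally have "\<bar>npow_form (real p + \<beta>) j d s\<bar> \<le> gfact p \<beta> / gfact (p - j) \<beta> * ?n" by (simp add: mult.assoc)
  then have "\<sigma> / gfact p \<beta> * \<bar>npow_form (real p + \<beta>) j d s\<bar> \<le> \<sigma> / gfact p \<beta> * (gfact p \<beta> / gfact (p - j) \<beta> * ?n)"
    using \<sigma> g by (intro mult_left_mono) auto
  then have "\<bar>\<sigma> / gfact p \<beta> * npow_form (real p + \<beta>) j d s\<bar> \<le> \<sigma> / gfact (p - j) \<beta> * ?n"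
    using \<sigma> g by (simp add: abs_mult)
  moreover have "\<bar>nabla f (replicate j d) (x + s) - taylor_deriv f p x j d s\<bar> \<le> L / gfact (p - j) \<beta> * ?n"
    using nabla_taylor_error[OF f \<beta> j, of d x s] by (simp add: mult.assoc)
  moreover have "(L + \<sigma>) / gfact (p - j) \<beta> * norm s powr (real (p - j) + \<beta>) * norm d ^ j =
      L / gfact (p - j) \<beta> * ?n + \<sigma> / gfact (p - j) \<beta> * ?n"
    by (simp add: add_divide_distrib distrib_right mult.assoc)
  ultimately show ?thesis unfolding nabla_model_eq[OF cd s] by linarith
qed

lemma chi_ge:
  assumes "1 \<le> q" "0 \<le> \<delta>" shows "\<delta> ^ q / fact q \<le> chi q \<delta>"
  unfolding chi_def using assms member_le_sum[of q "{1..q}" "\<lambda>l. \<delta> ^ l / fact l"] by simp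

text \<open>For steps of length at most 1 the error of order l = q dominates those of lower orders,
  both in the power and in the factorial. Summing its multiples by \<delta>^l / l! yields
  \<open>chi\<close>.\<close>

lemma phi_fun_le_phi_model:
  assumes f: "holder_class p \<beta> f f_low L" and \<beta>: "0 < \<beta>" and q: "q \<le> p"
    and s: "s \<noteq> 0" "norm s \<le> 1" and \<sigma>: "0 \<le> \<sigma>" and F: "x + s \<in> F" and \<delta>: "0 < \<delta>"
  shows "phi_fun f F q \<delta> (x + s) \<le> phi_model (model f p \<beta> x \<sigma>) F x q \<delta> s +
    (L + \<sigma>) * norm s powr (real (p - q) + \<beta>) / gfact (p - q) \<beta> * chi q \<delta>"
proof -
  let ?m = "model f p \<beta> x \<sigma>"
  let ?D = "{d. x + s + d \<in> F \<and> norm d \<le> \<delta>}"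
  define e where "e = (L + \<sigma>) * norm s powr (real (p - q) + \<beta>) / gfact (p - q) \<beta>"
  have cd: "cont_differentiable p f" and L: "0 \<le> L" using f unfolding holder_class_def by blast+
  have err: "\<bar>nabla f (replicate l d) (x + s) - nabla ?m (replicate l d) s\<bar> \<le> e * \<delta> ^ l"
    if l: "l \<le> q" and d: "norm d \<le> \<delta>" for l d
  proof -
    have "\<bar>nabla f (replicate l d) (x + s) - nabla ?m (replicate l d) s\<bar>
        \<le> (L + \<sigma>) / gfact (p - l) \<beta> * norm s powr (real (p - l) + \<beta>) * norm d ^ l"
      using l q by (intro nabla_model_error[OF f \<beta> _ s(1) \<sigma>]) simp
    also have "\<dots> \<le> (L + \<sigma>) / gfact (p - q) \<beta> * norm s powr (real (p - q) + \<beta>) * \<delta> ^ l"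
    proof (intro mult_mono divide_left_mono power_mono)
      show "gfact (p - q) \<beta> \<le> gfact (p - l) \<beta>" using l by (intro gfact_mono[OF \<beta>]) simp
      show "norm s powr (real (p - l) + \<beta>) \<le> norm s powr (real (p - q) + \<beta>)"
        using l s by (intro powr_mono') auto
    qed (use L \<sigma> d \<delta> gfact_pos[OF \<beta>] in \<open>auto intro!: mult_nonneg_nonneg mult_pos_pos divide_nonneg_pos\<close>)
    finally show ?thesis by (simp add: e_def)
  qed
  define M where "M d = - (\<Sum>l=1..q. 1 / fact l * nabla ?m (replicate l d) s)" for d
  have diff: "\<bar>(\<Sum>l=1..q. 1 / fact l * nabla f (replicate l d) (x + s)) + M d\<bar> \<le> e * chi q \<delta>"
    if d: "norm d \<le> \<delta>" for d
  proof -
    have "(\<Sum>l=1..q. 1 / fact l * nabla f (replicate l d) (x + s)) + M d =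
      (\<Sum>l=1..q. 1 / fact l * (nabla f (replicate l d) (x + s) - nabla ?m (replicate l d) s))"
      unfolding M_def by (simp add: sum_subtractf right_diff_distrib diff_divide_distrib)
    also have "\<bar>\<dots>\<bar> \<le> (\<Sum>l=1..q. 1 / fact l * (e * \<delta> ^ l))"
    proof (rule order_trans[OF sum_abs sum_mono])
      fix l assume "l \<in> {1..q}"
      then show "\<bar>1 / fact l * (nabla f (replicate l d) (x + s) - nabla ?m (replicate l d) s)\<bar> \<le> 1 / fact l * (e * \<delta> ^ l)"
        unfolding abs_mult using err[OF _ d, of l] by (intro mult_mono) auto
    qed
    also have "\<dots> = e * chi q \<delta>" by (simp add: chi_def sum_distrib_left)
    finally show ?thesis .
  qed
  \<comment> \<open>The supremum in \<open>phi_model\<close> can be used as an upper bound only for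
    a set that is bounded above.\<close>
  have bdd: "bdd_above (M ` ?D)"
  proof -
    obtain C where C: "\<And>l. 0 \<le> C l"
      "\<And>l m d y. l + m \<le> p \<Longrightarrow> \<bar>nabla f (replicate l d @ replicate m y) (x + s)\<bar> \<le> C (l + m) * norm d ^ l * norm y ^ m"
      using nabla_replicate_bounded[OF cd] by blast
    have "M d \<le> e * chi q \<delta> + (\<Sum>l=1..q. C l * \<delta> ^ l)" if d: "norm d \<le> \<delta>" for d
    proof -
      have "\<bar>\<Sum>l=1..q. 1 / fact l * nabla f (replicate l d) (x + s)\<bar> \<le> (\<Sum>l=1..q. C l * \<delta> ^ l)"
      proof (rule order_trans[OF sum_abs sum_mono])
        fix l assume l: "l \<in> {1..q}"
        have "\<bar>1 / fact l * nabla f (replicate l d) (x + s)\<bar> \<le> 1 * (C l * norm d ^ l)"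
          unfolding abs_mult using C(2)[of l 0 d 0] l q
          by (intro mult_mono) (simp_all add: divide_le_eq fact_ge_1)
        also have "\<dots> \<le> C l * \<delta> ^ l"
          using d C(1) by (simp add: mult_left_mono power_mono)
        finally show "\<bar>1 / fact l * nabla f (replicate l d) (x + s)\<bar> \<le> C l * \<delta> ^ l" .
      qed
      with diff[OF d] show ?thesis by linarith
    qed
    then show ?thesis by (intro bdd_aboveI2[of _ _ "e * chi q \<delta> + (\<Sum>l=1..q. C l * \<delta> ^ l)"]) auto
  qed
  have phi: "phi_model ?m F x q \<delta> s = (SUP d\<in>?D. M d)"
    unfolding phi_model_def M_def ..
  have "f (x + s) - (phi_model ?m F x q \<delta> s + e * chi q \<delta>) \<le> (INF d\<in>?D. taylor f q (x + s) d)"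
  proof (rule cINF_greatest)
    show "?D \<noteq> {}" using F \<delta> by (auto intro: exI[of _ 0])
    fix d assume d: "d \<in> ?D"
    have "M d \<le> phi_model ?m F x q \<delta> s" unfolding phi by (rule cSUP_upper[OF d bdd])
    moreover have "taylor f q (x + s) d = f (x + s) + (\<Sum>l=1..q. 1 / fact l * nabla f (replicate l d) (x + s))"
      by (simp add: taylor_def)
    ultimately show "f (x + s) - (phi_model ?m F x q \<delta> s + e * chi q \<delta>) \<le> taylor f q (x + s) d"
      using diff[of d] d by auto
  qed
  then show ?thesis unfolding phi_fun_def e_def by simp
qed

section \<open>Existence of an admissible step, and approximate minimality without feasible model
  decrease\<close>

lemma taylor_zero:
  assumes "cont_differentiable p f"
  shows "taylor f p x 0 = f x"
proof -
  have "nabla f (replicate l 0) x = 0" if "l \<in> {1..p}" for l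
    using symmetric_form_replicate_scaleR[OF nabla_symmetric_form[OF assms, of l x], of "[]" l 0 0] that by (simp add: power_0_left)
  then show ?thesis by (simp add: taylor_def)
qed

lemma model_zero:
  assumes "cont_differentiable p f" "0 < \<beta>"
  shows "model f p \<beta> x \<sigma> 0 = f x"
  using assms by (simp add: model_def taylor_zero)

lemma model_continuous:
  assumes f: "cont_differentiable p f" and "0 < \<beta>"
  shows "continuous_on UNIV (model f p \<beta> x \<sigma>)"
proof -
  have "continuous_on UNIV (taylor f p x)"
    unfolding taylor_deriv_0[of f p x 0, symmetric] using taylor_deriv_has_derivative[OF f]
    by (metis continuous_at_imp_continuous_on has_derivative_continuous)
  moreover have "continuous_on UNIV (\<lambda>s::'a. norm s powr (real p + \<beta>))"
    using assms(2) by (intro continuous_on_powr' continuous_intros) auto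
  ultimately have "continuous_on UNIV (\<lambda>s. taylor f p x s + \<sigma> / gfact p \<beta> * norm s powr (real p + \<beta>))"
    by (intro continuous_on_add continuous_on_mult_left)
  then show ?thesis by (simp add: model_def[abs_def])
qed

lemma nabla_model_line_derivative:
  assumes f: "cont_differentiable p f" and y: "y + t *\<^sub>R d \<noteq> 0"
  shows "((\<lambda>t. nabla (model f p \<beta> x \<sigma>) (replicate i d) (y + t *\<^sub>R d)) has_real_derivative
    nabla (model f p \<beta> x \<sigma>) (replicate (Suc i) d) (y + t *\<^sub>R d)) (at t)"
proof -
  let ?E = "\<lambda>i y. taylor_deriv f p x i d y + \<sigma> / gfact p \<beta> * npow_form (real p + \<beta>) i d y"
  obtain D1 D2 where D: "(taylor_deriv f p x i d has_derivative D1) (at (y + t *\<^sub>R d))" "D1 d = taylor_deriv f p x (Suc i) d (y + t *\<^sub>R d)"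
    "(npow_form (real p + \<beta>) i d has_derivative D2) (at (y + t *\<^sub>R d))" "D2 d = npow_form (real p + \<beta>) (Suc i) d (y + t *\<^sub>R d)"
    using taylor_deriv_has_derivative[OF f, of x i d] npow_form_has_derivative[OF y, of "real p + \<beta>" i d] by blast
  have "(?E i has_derivative (\<lambda>h. D1 h + \<sigma> / gfact p \<beta> * D2 h)) (at (y + t *\<^sub>R d))"
    by (intro has_derivative_add has_derivative_mult_right D)
  then have "(nabla (model f p \<beta> x \<sigma>) (replicate i d) has_derivative (\<lambda>h. D1 h + \<sigma> / gfact p \<beta> * D2 h)) (at (y + t *\<^sub>R d))"
    by (rule has_derivative_transform_within_open[of _ _ _ _ "- {0}"]) (use y in \<open>auto simp: nabla_model_eq[OF f]\<close>)
  from has_derivative_imp_line_derivative[OF this] show ?thesis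
    unfolding nabla_model_eq[OF f y] D .
qed

text \<open>An annulus instead of a ball, since the exponent p + \<beta> - i may be negative. With
  \<rho> half the norm of a step it contains the segments used for Taylor's formula.\<close>

lemma nabla_model_bounded:
  assumes f: "cont_differentiable p f" and \<rho>: "0 < \<rho>"
  obtains C where "0 \<le> C" "\<And>y d. \<rho> \<le> norm y \<Longrightarrow> norm y \<le> 3 * \<rho> \<Longrightarrow>
    \<bar>nabla (model f p \<beta> x \<sigma>) (replicate i d) y\<bar> \<le> C * norm d ^ i"
proof -
  obtain B where B: "\<And>l. 0 \<le> B l"
      "\<And>l m d y. l + m \<le> p \<Longrightarrow> \<bar>nabla f (replicate l d @ replicate m y) x\<bar> \<le> B (l + m) * norm d ^ l * norm y ^ m"
    using nabla_replicate_bounded[OF f] by blast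
  obtain K where K: "0 \<le> K" "\<And>d y::'a. \<bar>npow_form (real p + \<beta>) i d y\<bar> \<le> K * norm y powr (real p + \<beta> - real i) * norm d ^ i"
    using npow_form_bounded by blast
  define a where "a = real p + \<beta> - real i"
  define C1 where "C1 = (\<Sum>m<Suc p - i. 1 / fact m * (B (i + m) * (3 * \<rho>) ^ m))"
  define C2 where "C2 = K * (\<rho> powr a + (3 * \<rho>) powr a)"
  have C12: "0 \<le> C1" "0 \<le> C2" unfolding C1_def C2_def using B K \<rho>
    by (auto intro!: sum_nonneg mult_nonneg_nonneg)
  show ?thesis
  proof (rule that[of "C1 + \<bar>\<sigma> / gfact p \<beta>\<bar> * C2"])
    show "0 \<le> C1 + \<bar>\<sigma> / gfact p \<beta>\<bar> * C2" using C12 by simp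
    fix y d :: 'a assume y: "\<rho> \<le> norm y" "norm y \<le> 3 * \<rho>"
    then have y0: "y \<noteq> 0" using \<rho> by auto
    have "\<bar>taylor_deriv f p x i d y\<bar> \<le> (\<Sum>m<Suc p - i. 1 / fact m * (B (i + m) * (3 * \<rho>) ^ m) * norm d ^ i)"
      unfolding taylor_deriv_def
    proof (rule order_trans[OF sum_abs sum_mono])
      fix m assume m: "m \<in> {..<Suc p - i}"
      have "\<bar>nabla f (replicate i d @ replicate m y) x\<bar> \<le> B (i + m) * norm d ^ i * norm y ^ m"
        using m by (intro B) auto
      also have "\<dots> \<le> B (i + m) * norm d ^ i * (3 * \<rho>) ^ m"
        using y B by (intro mult_left_mono power_mono) auto
      finally have "1 / fact m * \<bar>nabla f (replicate i d @ replicate m y) x\<bar> \<le> 1 / fact m * (B (i + m) * norm d ^ i * (3 * \<rho>) ^ m)"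
        by (intro mult_left_mono) auto
      then show "\<bar>1 / fact m * nabla f (replicate i d @ replicate m y) x\<bar> \<le> 1 / fact m * (B (i + m) * (3 * \<rho>) ^ m) * norm d ^ i"
        by (simp add: abs_mult mult_ac)
    qed
    also have "\<dots> = C1 * norm d ^ i" by (simp add: C1_def sum_distrib_right)
    finally have 1: "\<bar>taylor_deriv f p x i d y\<bar> \<le> C1 * norm d ^ i" .
    have "norm y powr a \<le> \<rho> powr a + (3 * \<rho>) powr a"
    proof (cases "0 \<le> a")
      case True
      then have "norm y powr a \<le> (3 * \<rho>) powr a" using y by (intro powr_mono2) auto
      then show ?thesis using powr_ge_zero[of \<rho> a] by linarith
    next
      case False
      then have "norm y powr a \<le> \<rho> powr a" using y \<rho> by (intro powr_mono2') auto
      then show ?thesis using powr_ge_zero[of "3 * \<rho>" a] by linarith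
    qed
    then have "K * norm y powr a * norm d ^ i \<le> C2 * norm d ^ i"
      unfolding C2_def using K by (intro mult_right_mono mult_left_mono) auto
    with K(2)[of d y] have "\<bar>npow_form (real p + \<beta>) i d y\<bar> \<le> C2 * norm d ^ i"
      unfolding a_def[symmetric] by linarith
    then have "\<bar>\<sigma> / gfact p \<beta>\<bar> * \<bar>npow_form (real p + \<beta>) i d y\<bar> \<le> \<bar>\<sigma> / gfact p \<beta>\<bar> * (C2 * norm d ^ i)"
      by (intro mult_left_mono) auto
    then have 2: "\<bar>\<sigma> / gfact p \<beta> * npow_form (real p + \<beta>) i d y\<bar> \<le> \<bar>\<sigma> / gfact p \<beta>\<bar> * C2 * norm d ^ i"
      by (simp only: abs_mult mult.assoc)
    have "\<bar>u + v\<bar> \<le> a + b" if "\<bar>u\<bar> \<le> a" "\<bar>v\<bar> \<le> b" for u v a b :: real using that by linarith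
    from this[OF 1 2] show "\<bar>nabla (model f p \<beta> x \<sigma>) (replicate i d) y\<bar> \<le> (C1 + \<bar>\<sigma> / gfact p \<beta>\<bar> * C2) * norm d ^ i"
      unfolding nabla_model_eq[OF f y0] by (simp only: distrib_right)
  qed
qed

text \<open>The bound on \<open>d\<close> keeps the segment away from the origin, where the model need not be smooth.\<close>
lemma model_taylor_bound:
  assumes f: "cont_differentiable p f" and s: "s \<noteq> 0"
  obtains C where "0 \<le> C" "\<And>d. norm d \<le> norm s / 2 \<Longrightarrow>
    \<bar>model f p \<beta> x \<sigma> (s + d) - model f p \<beta> x \<sigma> s - (\<Sum>l=1..q. 1 / fact l * nabla (model f p \<beta> x \<sigma>) (replicate l d) s)\<bar>
      \<le> C * norm d ^ Suc q"
proof -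
  let ?m = "model f p \<beta> x \<sigma>"
  have "0 < norm s / 2" using s by simp
  from nabla_model_bounded[OF f this, of \<beta> x \<sigma> "Suc q"]
  obtain C where C: "0 \<le> C" "\<And>y d. norm s / 2 \<le> norm y \<Longrightarrow> norm y \<le> 3 * (norm s / 2) \<Longrightarrow>
      \<bar>nabla ?m (replicate (Suc q) d) y\<bar> \<le> C * norm d ^ Suc q" by blast
  show ?thesis
  proof (rule that[OF C(1)])
    fix d :: 'a assume d: "norm d \<le> norm s / 2"
    have rng: "norm s / 2 \<le> norm (s + t *\<^sub>R d)" "norm (s + t *\<^sub>R d) \<le> 3 * (norm s / 2)" if "0 \<le> t" "t \<le> 1" for t
    proof -
      have "norm (t *\<^sub>R d) \<le> norm s / 2"
        using d that mult_mono[of t 1 "norm d" "norm s / 2"] by auto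
      then show "norm s / 2 \<le> norm (s + t *\<^sub>R d)" "norm (s + t *\<^sub>R d) \<le> 3 * (norm s / 2)"
        using norm_triangle_ineq[of s "t *\<^sub>R d"] norm_diff_ineq[of s "t *\<^sub>R d"] by auto
    qed
    define g where "g l t = nabla ?m (replicate l d) (s + t *\<^sub>R d)" for l t
    have "\<exists>t>0. t < 1 \<and> g 0 1 = (\<Sum>l<Suc q. g l 0 / fact l * (1 - 0) ^ l) + g (Suc q) t / fact (Suc q) * (1 - 0) ^ Suc q"
    proof (rule Taylor_up[where a = 0])
      show "\<forall>l t. l < Suc q \<and> 0 \<le> t \<and> t \<le> 1 \<longrightarrow> (g l has_real_derivative g (Suc l) t) (at t)"
      proof (intro allI impI)
        fix l t assume "l < Suc q \<and> 0 \<le> t \<and> (t::real) \<le> 1"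
        then have "s + t *\<^sub>R d \<noteq> 0" using rng[of t] s by auto
        from nabla_model_line_derivative[OF f this] show "(g l has_real_derivative g (Suc l) t) (at t)"
          unfolding g_def .
      qed
    qed auto
    then obtain t where t: "0 < t" "t < 1" "g 0 1 = (\<Sum>l<Suc q. g l 0 / fact l) + g (Suc q) t / fact (Suc q)"
      by auto
    have "(\<Sum>l<Suc q. g l 0 / fact l) = ?m s + (\<Sum>l=1..q. 1 / fact l * nabla ?m (replicate l d) s)"
    proof -
      have "{..<Suc q} = insert 0 {1..q}" by auto
      then show ?thesis by (simp add: g_def)
    qed
    then have "?m (s + d) - ?m s - (\<Sum>l=1..q. 1 / fact l * nabla ?m (replicate l d) s) = g (Suc q) t / fact (Suc q)"
      using t(3) by (simp add: g_def)
    also have "\<bar>\<dots>\<bar> \<le> \<bar>g (Suc q) t\<bar>"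
      by (simp add: abs_divide divide_le_eq mult_le_cancel_left1 fact_ge_1 del: fact_Suc)
    also have "\<dots> \<le> C * norm d ^ Suc q"
      unfolding g_def using rng[of t] t by (intro C) auto
    finally show "\<bar>?m (s + d) - ?m s - (\<Sum>l=1..q. 1 / fact l * nabla ?m (replicate l d) s)\<bar> \<le> C * norm d ^ Suc q" .
  qed
qed

lemma model_coercive:
  assumes f: "cont_differentiable p f" and p: "1 \<le> p" and \<beta>: "0 < \<beta>" and \<sigma>: "0 < \<sigma>"
  shows "bounded {s. model f p \<beta> x \<sigma> s < model f p \<beta> x \<sigma> 0}"
proof -
  obtain B where B: "\<And>l. 0 \<le> B l"
      "\<And>l m d y. l + m \<le> p \<Longrightarrow> \<bar>nabla f (replicate l d @ replicate m y) x\<bar> \<le> B (l + m) * norm d ^ l * norm y ^ m"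
    using nabla_replicate_bounded[OF f] by blast
  define C where "C = (\<Sum>l=1..p. B l)"
  define c where "c = \<sigma> / gfact p \<beta>"
  have c: "0 < c" unfolding c_def using \<sigma> gfact_pos[OF \<beta>] by simp
  have C: "0 \<le> C" unfolding C_def using B by (intro sum_nonneg) auto
  \<comment> \<open>Beyond 1 every power is at most the p-th; beyond the other value the
    regularization, of degree p + \<beta>, outweighs all Taylor terms.\<close>
  define R where "R = max 1 ((C / c) powr (1 / \<beta>))"
  have "norm s \<le> R" if lt: "model f p \<beta> x \<sigma> s < model f p \<beta> x \<sigma> 0" for s
  proof (rule ccontr)
    assume "\<not> norm s \<le> R"
    then have s: "1 < norm s" "(C / c) powr (1 / \<beta>) < norm s" unfolding R_def by auto
    have "((C / c) powr (1 / \<beta>)) powr \<beta> \<le> norm s powr \<beta>"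
      using s \<beta> by (intro powr_mono2) auto
    then have "C / c \<le> norm s powr \<beta>" using \<beta> C c by (simp add: powr_powr)
    then have "C \<le> c * norm s powr \<beta>" using c by (simp add: field_simps)
    have "\<bar>\<Sum>l=1..p. 1 / fact l * nabla f (replicate l s) x\<bar> \<le> (\<Sum>l=1..p. B l * norm s ^ p)"
    proof (rule order_trans[OF sum_abs sum_mono])
      fix l assume l: "l \<in> {1..p}"
      have "\<bar>1 / fact l * nabla f (replicate l s) x\<bar> \<le> 1 * (B l * norm s ^ l)"
        unfolding abs_mult using B(2)[of l 0 s 0] l
        by (intro mult_mono) (simp_all add: divide_le_eq fact_ge_1)
      also have "\<dots> \<le> B l * norm s ^ p"
        using l s B(1) by (simp add: mult_left_mono power_increasing)
      finally show "\<bar>1 / fact l * nabla f (replicate l s) x\<bar> \<le> B l * norm s ^ p" .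
    qed
    also have "\<dots> = C * norm s ^ p" by (simp add: C_def sum_distrib_right)
    also have "\<dots> \<le> c * norm s powr \<beta> * norm s ^ p"
      using \<open>C \<le> c * norm s powr \<beta>\<close> by (intro mult_right_mono) auto
    also have "\<dots> = c * norm s powr (real p + \<beta>)"
    proof -
      have "s \<noteq> 0" using s by auto
      then show ?thesis by (simp add: powr_add powr_realpow)
    qed
    finally have "f x \<le> model f p \<beta> x \<sigma> s" unfolding model_def taylor_def c_def[symmetric] by linarith
    then show False using lt model_zero[OF f \<beta>, of x \<sigma>] by simp
  qed
  then show ?thesis by (intro boundedI) auto
qed

text \<open>At a minimizer, Taylor's formula bounds \<open>phi_model\<close> by a multiple of
  \<delta>^(q+1), while the threshold in condition (ii) is at least a multiple of
  \<delta>^q.\<close>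

lemma admissible_step_exists:
  assumes f: "cont_differentiable p f" and p: "1 \<le> p" and q: "1 \<le> q" and \<beta>: "0 < \<beta>" and \<sigma>: "0 < \<sigma>" and \<theta>: "0 < \<theta>"
    and F: "closed F" and s0: "x + s0 \<in> F" "model f p \<beta> x \<sigma> s0 < model f p \<beta> x \<sigma> 0"
  obtains s \<delta> where "admissible_step f F p q \<beta> \<epsilon> \<omega> \<theta> x \<sigma> s \<delta>"
proof -
  let ?m = "model f p \<beta> x \<sigma>"
  \<comment> \<open>The level of \<open>s0\<close> gives a closed set and still keeps the minimizer
    strictly below the value at 0, hence away from 0.\<close>
  define A where "A = {s. x + s \<in> F \<and> ?m s \<le> ?m s0}"
  have "A \<subseteq> {s. ?m s < ?m 0}" unfolding A_def using s0 by auto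
  then have "bounded A" using model_coercive[OF f p \<beta> \<sigma>] bounded_subset by blast
  moreover have "closed A"
  proof -
    have "closed ((\<lambda>s. x + s) -` F)" by (intro closed_vimage F continuous_intros)
    moreover have "closed {s. ?m s \<le> ?m s0}"
      by (intro closed_Collect_le model_continuous[OF f \<beta>] continuous_intros)
    moreover have "A = ((\<lambda>s. x + s) -` F) \<inter> {s. ?m s \<le> ?m s0}" unfolding A_def by auto
    ultimately show ?thesis by auto
  qed
  ultimately have "compact A" using compact_eq_bounded_closed by blast
  moreover have "s0 \<in> A" using s0 by (auto simp: A_def)
  ultimately have "\<exists>s\<in>A. \<forall>y\<in>A. ?m s \<le> ?m y"
    using continuous_on_subset[OF model_continuous[OF f \<beta>] subset_UNIV]
    by (intro continuous_attains_inf) auto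
  then obtain s where s: "s \<in> A" "\<And>y. y \<in> A \<Longrightarrow> ?m s \<le> ?m y" by blast
  have min: "?m s \<le> ?m y" if y: "x + y \<in> F" for y
  proof (cases "?m y \<le> ?m s0")
    case True
    with y show ?thesis by (intro s(2)) (simp add: A_def)
  next
    case False
    with s(1) show ?thesis by (simp add: A_def)
  qed
  have sF: "x + s \<in> F" and dec: "?m s < ?m 0" using s(1) s0 by (auto simp: A_def)
  then have sn: "s \<noteq> 0" by auto
  obtain C where C: "0 \<le> C" "\<And>d. norm d \<le> norm s / 2 \<Longrightarrow>
      \<bar>?m (s + d) - ?m s - (\<Sum>l=1..q. 1 / fact l * nabla ?m (replicate l d) s)\<bar> \<le> C * norm d ^ Suc q"
    using model_taylor_bound[OF f sn] by blast
  define e where "e = \<theta> * norm s powr (real (p - q) + \<beta>) / gfact (p - q) \<beta>"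
  have e: "0 < e" unfolding e_def using \<theta> sn gfact_pos[OF \<beta>] by simp
  \<comment> \<open>Half the norm of \<open>s\<close> is the range of the Taylor bound; the last
    entry gives C \<delta> \<le> e / q!, with C + 1 guarding against C = 0.\<close>
  define \<delta> where "\<delta> = min (min 1 (norm s / 2)) (e / (fact q * (C + 1)))"
  have "0 < \<delta>" unfolding \<delta>_def using sn e C(1) by auto
  moreover have "\<delta> \<le> 1" "\<delta> \<le> norm s / 2" "\<delta> \<le> e / (fact q * (C + 1))"
    unfolding \<delta>_def by linarith+
  ultimately have \<delta>: "0 < \<delta>" "\<delta> \<le> 1" "\<delta> \<le> norm s / 2" "\<delta> \<le> e / (fact q * (C + 1))" .
  have "phi_model ?m F x q \<delta> s \<le> C * \<delta> ^ Suc q"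
    unfolding phi_model_def
  proof (rule cSUP_least)
    show "{d. x + s + d \<in> F \<and> norm d \<le> \<delta>} \<noteq> {}" using sF \<delta> by (auto intro: exI[of _ 0])
    fix d assume d: "d \<in> {d. x + s + d \<in> F \<and> norm d \<le> \<delta>}"
    then have "?m s \<le> ?m (s + d)" by (intro min) (simp add: add.assoc)
    moreover have "C * norm d ^ Suc q \<le> C * \<delta> ^ Suc q"
      using d C(1) by (intro mult_left_mono power_mono) auto
    ultimately show "- (\<Sum>l=1..q. 1 / fact l * nabla ?m (replicate l d) s) \<le> C * \<delta> ^ Suc q"
      using C(2)[of d] d \<delta> by auto
  qed
  also have "\<dots> \<le> e * (\<delta> ^ q / fact q)"
  proof -
    have "C * \<delta> \<le> (C + 1) * \<delta>" using \<delta> by simp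
    also have "\<dots> \<le> (C + 1) * (e / (fact q * (C + 1)))"
      using \<delta>(4) C(1) by (intro mult_left_mono) auto
    also have "\<dots> = e / fact q" using C(1) by simp
    finally have "C * \<delta> * \<delta> ^ q \<le> e / fact q * \<delta> ^ q" using \<delta> by (intro mult_right_mono) auto
    then show ?thesis by (simp add: mult.assoc)
  qed
  also have "\<dots> \<le> e * chi q \<delta>" using e chi_ge[OF q, of \<delta>] \<delta> by (intro mult_left_mono) auto
  finally have "admissible_step f F p q \<beta> \<epsilon> \<omega> \<theta> x \<sigma> s \<delta>"
    unfolding admissible_step_def e_def using sF dec \<delta> by simp
  then show ?thesis by (rule that)
qed

text \<open>Since q + 1 and p + \<beta> are both at least q + \<beta>, the Taylor terms beyond order
  q and the regularization are bounded by C \<delta>^(q+\<beta>); the radius is chosen so that this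
  stays below \<epsilon> \<delta>^q / q!.\<close>

lemma phi_fun_small_of_model_minimal:
  assumes f: "cont_differentiable p f" and q: "1 \<le> q" "q \<le> p" and \<beta>: "0 < \<beta>" "\<beta> \<le> 1" and \<sigma>: "0 < \<sigma>"
    and \<epsilon>: "0 < \<epsilon>" and x: "x \<in> F"
    and min: "\<And>s. x + s \<in> F \<Longrightarrow> model f p \<beta> x \<sigma> 0 \<le> model f p \<beta> x \<sigma> s"
  obtains \<delta> where "0 < \<delta>" "\<delta> \<le> 1" "phi_fun f F q \<delta> x \<le> \<epsilon> * chi q \<delta>"
proof -
  obtain B where B: "\<And>l. 0 \<le> B l"
      "\<And>l m d y. l + m \<le> p \<Longrightarrow> \<bar>nabla f (replicate l d @ replicate m y) x\<bar> \<le> B (l + m) * norm d ^ l * norm y ^ m"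
    using nabla_replicate_bounded[OF f] by blast
  define c where "c = \<sigma> / gfact p \<beta>"
  have c: "0 < c" unfolding c_def using \<sigma> gfact_pos[OF \<beta>(1)] by simp
  define C where "C = c + (\<Sum>l=Suc q..p. B l)"
  have C: "0 < C" unfolding C_def using c B by (intro add_pos_nonneg sum_nonneg) auto
  define \<delta> where "\<delta> = min 1 ((\<epsilon> / (C * fact q)) powr (1 / \<beta>))"
  have \<delta>: "0 < \<delta>" "\<delta> \<le> 1" "\<delta> \<le> (\<epsilon> / (C * fact q)) powr (1 / \<beta>)" unfolding \<delta>_def using \<epsilon> C by auto
  have "\<delta> powr \<beta> \<le> ((\<epsilon> / (C * fact q)) powr (1 / \<beta>)) powr \<beta>"
    using \<delta> \<beta> by (intro powr_mono2) auto
  then have db: "\<delta> powr \<beta> \<le> \<epsilon> / (C * fact q)" using \<beta> \<epsilon> C by (simp add: powr_powr)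
  have "f x - \<epsilon> * chi q \<delta> \<le> (INF d\<in>{d. x + d \<in> F \<and> norm d \<le> \<delta>}. taylor f q x d)"
  proof (rule cINF_greatest)
    show "{d. x + d \<in> F \<and> norm d \<le> \<delta>} \<noteq> {}" using x \<delta> by (auto intro: exI[of _ 0])
    fix d assume d: "d \<in> {d. x + d \<in> F \<and> norm d \<le> \<delta>}"
    have split: "taylor f p x d = taylor f q x d + (\<Sum>l=Suc q..p. 1 / fact l * nabla f (replicate l d) x)"
    proof -
      have "{1..p} = {1..q} \<union> {Suc q..p}" using q by auto
      then have "(\<Sum>l=1..p. 1 / fact l * nabla f (replicate l d) x) =
          (\<Sum>l=1..q. 1 / fact l * nabla f (replicate l d) x) + (\<Sum>l=Suc q..p. 1 / fact l * nabla f (replicate l d) x)"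
        by (simp only:) (rule sum.union_disjoint, auto)
      then show ?thesis by (simp add: taylor_def)
    qed
    have "\<bar>\<Sum>l=Suc q..p. 1 / fact l * nabla f (replicate l d) x\<bar> \<le> (\<Sum>l=Suc q..p. B l * \<delta> powr (real q + \<beta>))"
    proof (rule order_trans[OF sum_abs sum_mono])
      fix l assume l: "l \<in> {Suc q..p}"
      have "\<bar>1 / fact l * nabla f (replicate l d) x\<bar> \<le> 1 * (B l * norm d ^ l)"
        unfolding abs_mult using B(2)[of l 0 d 0] l
        by (intro mult_mono) (simp_all add: divide_le_eq fact_ge_1)
      also have "\<dots> \<le> B l * \<delta> ^ l"
        using d B(1) by (simp add: mult_left_mono power_mono)
      also have "\<delta> ^ l = \<delta> powr real l" using \<delta> by (simp add: powr_realpow)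
      also have "B l * \<delta> powr real l \<le> B l * \<delta> powr (real q + \<beta>)"
        using l \<beta> \<delta> B(1) by (intro mult_left_mono powr_mono') auto
      finally show "\<bar>1 / fact l * nabla f (replicate l d) x\<bar> \<le> B l * \<delta> powr (real q + \<beta>)" .
    qed
    also have "\<dots> = (\<Sum>l=Suc q..p. B l) * \<delta> powr (real q + \<beta>)" by (simp add: sum_distrib_right)
    finally have 1: "\<bar>\<Sum>l=Suc q..p. 1 / fact l * nabla f (replicate l d) x\<bar> \<le> (\<Sum>l=Suc q..p. B l) * \<delta> powr (real q + \<beta>)" .
    have 2: "c * norm d powr (real p + \<beta>) \<le> c * \<delta> powr (real q + \<beta>)"
    proof (rule mult_left_mono)
      have "norm d powr (real p + \<beta>) \<le> \<delta> powr (real p + \<beta>)" using d \<beta> by (intro powr_mono2) auto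
      also have "\<dots> \<le> \<delta> powr (real q + \<beta>)" using \<delta> q by (intro powr_mono') auto
      finally show "norm d powr (real p + \<beta>) \<le> \<delta> powr (real q + \<beta>)" .
    qed (use c in simp)
    have 3: "C * \<delta> powr (real q + \<beta>) \<le> \<epsilon> * chi q \<delta>"
    proof -
      have "C * \<delta> powr (real q + \<beta>) = C * \<delta> ^ q * \<delta> powr \<beta>" using \<delta> by (simp add: powr_add powr_realpow)
      also have "\<dots> \<le> C * \<delta> ^ q * (\<epsilon> / (C * fact q))" using db C \<delta> by (intro mult_left_mono) auto
      also have "\<dots> = \<epsilon> * (\<delta> ^ q / fact q)" using C by simp
      also have "\<dots> \<le> \<epsilon> * chi q \<delta>" using \<epsilon> chi_ge[OF q(1), of \<delta>] \<delta> by (intro mult_left_mono) auto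
      finally show ?thesis .
    qed
    have "f x \<le> taylor f p x d + c * norm d powr (real p + \<beta>)"
      using min[of d] d model_zero[OF f \<beta>(1), of x \<sigma>] by (simp add: model_def c_def)
    with 1 2 3 split show "f x - \<epsilon> * chi q \<delta> \<le> taylor f q x d"
      unfolding C_def distrib_right by linarith
  qed
  then have "phi_fun f F q \<delta> x \<le> \<epsilon> * chi q \<delta>" unfolding phi_fun_def by simp
  with \<delta> show ?thesis using that by blast
qed

section \<open>Complexity of the algorithm\<close>

lemma admissible_step_decrease:
  assumes f: "cont_differentiable p f" and \<beta>: "0 < \<beta>"
    and a: "admissible_step f F p q \<beta> \<epsilon> \<omega> \<theta> x \<sigma> s \<delta>"
  shows "s \<noteq> 0" "\<sigma> / gfact p \<beta> * norm s powr (real p + \<beta>) < taylor f p x 0 - taylor f p x s"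
proof -
  have lt: "model f p \<beta> x \<sigma> s < model f p \<beta> x \<sigma> 0" using a unfolding admissible_step_def by blast
  then show "s \<noteq> 0" by auto
  show "\<sigma> / gfact p \<beta> * norm s powr (real p + \<beta>) < taylor f p x 0 - taylor f p x s"
    using lt model_zero[OF f \<beta>, of x \<sigma>] taylor_zero[OF f, of x] by (simp add: model_def)
qed

text \<open>1 - \<rho> is the Taylor error, at most L g, divided by a predicted decrease larger than
  \<sigma> g; so it is at most L / \<sigma>.\<close>

lemma rho_ge_of_large_weight:
  assumes f: "holder_class p \<beta> f f_low L" and \<beta>: "0 < \<beta>" and \<eta>: "\<eta> < 1"
    and a: "admissible_step f F p q \<beta> \<epsilon> \<omega> \<theta> x \<sigma> s \<delta>"
    and \<sigma>: "0 < \<sigma>" "L / (1 - \<eta>) \<le> \<sigma>"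
  shows "\<eta> \<le> rho f p x s"
proof -
  have cd: "cont_differentiable p f" using f unfolding holder_class_def by blast
  note dec = admissible_step_decrease[OF cd \<beta> a]
  define g where "g = norm s powr (real p + \<beta>) / gfact p \<beta>"
  define T where "T = taylor f p x 0 - taylor f p x s"
  have g: "0 < g" unfolding g_def using dec(1) gfact_pos[OF \<beta>] by simp
  have T: "\<sigma> * g < T" using dec(2) by (simp add: g_def T_def)
  have T0: "0 < T" using T g \<sigma> by (meson mult_pos_pos less_trans)
  have "f (x + s) - taylor f p x s \<le> L * g"
    using nabla_taylor_error[OF f \<beta>, of 0 s x s] taylor_deriv_0[of f p x s] by (simp add: g_def)
  moreover have "L * g \<le> (1 - \<eta>) * (\<sigma> * g)"
    using \<sigma> \<eta> g by (simp add: divide_le_eq mult.commute)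
  moreover have "(1 - \<eta>) * (\<sigma> * g) \<le> (1 - \<eta>) * T" using T \<eta> by (intro mult_left_mono) auto
  ultimately have "\<eta> * T \<le> f x - f (x + s)"
    using taylor_zero[OF cd, of x] by (simp add: T_def algebra_simps)
  then show ?thesis unfolding rho_def T_def[symmetric] using T0 by (simp add: le_divide_eq)
qed

text \<open>The two entries of the maximum belong to the two ways of accepting a step: being long,
  or passing the model test, where failure of the stopping test at x + s forces \<epsilon> < K
  |s|^(p-q+\<beta>).\<close>

lemma step_lower_bound:
  assumes f: "holder_class p \<beta> f f_low L" and \<beta>: "0 < \<beta>" and q: "1 \<le> q" "q \<le> p"
    and \<epsilon>: "0 < \<epsilon>" "\<epsilon> < 1" and \<omega>: "0 < \<omega>" "\<omega> \<le> 1" and \<theta>: "0 < \<theta>"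
    and a: "admissible_step f F p q \<beta> \<epsilon> \<omega> \<theta> x \<sigma> s \<delta>"
    and \<sigma>: "0 < \<sigma>" "\<sigma> \<le> \<sigma>_max"
    and nstop: "\<not> stop_test f F q \<epsilon> (x + s) \<delta>"
  shows "\<epsilon> powr ((real p + \<beta>) / (real (p - q) + \<beta>)) \<le> norm s powr (real p + \<beta>) *
    max (\<omega> powr (- (real p + \<beta>)))
      (((L + \<sigma>_max + \<theta>) / gfact (p - q) \<beta>) powr ((real p + \<beta>) / (real (p - q) + \<beta>)))"
    (is "?E \<le> ?S * max ?M1 ?M2")
proof -
  have cd: "cont_differentiable p f" and L: "0 \<le> L" using f unfolding holder_class_def by blast+
  define a where "a = real (p - q) + \<beta>"
  define b where "b = real p + \<beta>"
  have ab: "0 < a" "0 < b" using \<beta> by (auto simp: a_def b_def)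
  have s: "s \<noteq> 0" using admissible_step_decrease[OF cd \<beta> assms(10)] by blast
  have adm: "x + s \<in> F" "0 < \<delta>" "\<delta> \<le> 1"
    "\<omega> * \<epsilon> powr (1 / a) \<le> norm s \<or> phi_model (model f p \<beta> x \<sigma>) F x q \<delta> s \<le> \<theta> * norm s powr a / gfact (p - q) \<beta> * chi q \<delta>"
    using assms(10) unfolding admissible_step_def a_def by blast+
  show ?thesis
  proof (cases "\<omega> * \<epsilon> powr (1 / a) \<le> norm s")
    case True
    have "(\<omega> * \<epsilon> powr (1 / a)) powr b \<le> ?S"
      unfolding b_def[symmetric] using True \<omega> \<epsilon> ab by (intro powr_mono2) auto
    then have "\<omega> powr b * \<epsilon> powr (b / a) \<le> ?S" using \<omega> by (simp add: powr_mult powr_powr)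
    then have "\<omega> powr (- b) * (\<omega> powr b * \<epsilon> powr (b / a)) \<le> \<omega> powr (- b) * ?S"
      by (intro mult_left_mono) auto
    moreover have "\<omega> powr (- b) * (\<omega> powr b * \<epsilon> powr (b / a)) = \<epsilon> powr (b / a)"
      using \<omega> by (simp add: powr_minus)
    ultimately have "?E \<le> ?S * ?M1"
      unfolding a_def[symmetric] b_def[symmetric] by (simp only: mult.commute)
    also have "\<dots> \<le> ?S * max ?M1 ?M2" by (intro mult_left_mono) auto
    finally show ?thesis .
  next
    case False
    \<comment> \<open>A step that is not long is shorter than 1, as the comparison of the
      criticality measures needs.\<close>
    have "\<epsilon> powr (1 / a) \<le> 1" using \<epsilon> ab by (intro powr_le1) auto
    then have "\<omega> * \<epsilon> powr (1 / a) \<le> 1 * 1" using \<omega> by (intro mult_mono) auto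
    then have s1: "norm s \<le> 1" using False by auto
    define K where "K = (L + \<sigma>_max + \<theta>) / gfact (p - q) \<beta>"
    have g: "0 < gfact (p - q) \<beta>" using gfact_pos[OF \<beta>] .
    have K: "0 < K" unfolding K_def using L \<sigma> \<theta> g by simp
    have "0 < \<delta> ^ q / fact q" using adm by simp
    then have chi: "0 < chi q \<delta>" using chi_ge[OF q(1), of \<delta>] adm by linarith
    have "\<epsilon> * chi q \<delta> < phi_fun f F q \<delta> (x + s)" using nstop unfolding stop_test_def by simp
    also have "\<dots> \<le> phi_model (model f p \<beta> x \<sigma>) F x q \<delta> s + (L + \<sigma>) * norm s powr a / gfact (p - q) \<beta> * chi q \<delta>"
      unfolding a_def using \<sigma> by (intro phi_fun_le_phi_model[OF f \<beta> q(2) s s1 _ adm(1,2)]) simp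
    also have "\<dots> \<le> \<theta> * norm s powr a / gfact (p - q) \<beta> * chi q \<delta> + (L + \<sigma>_max) * norm s powr a / gfact (p - q) \<beta> * chi q \<delta>"
      using adm(4) False \<sigma> g chi by (intro add_mono mult_right_mono divide_right_mono) auto
    also have "\<dots> = K * norm s powr a * chi q \<delta>"
      by (simp add: K_def add_divide_distrib distrib_right)
    finally have "\<epsilon> < K * norm s powr a" using chi by simp
    then have "\<epsilon> powr (b / a) \<le> (K * norm s powr a) powr (b / a)"
      using ab \<epsilon> by (intro powr_mono2) auto
    also have "\<dots> = K powr (b / a) * ?S"
      using K ab by (simp add: powr_mult powr_powr b_def)
    finally have "?E \<le> ?S * ?M2"
      unfolding K_def a_def[symmetric] b_def[symmetric] by (simp add: mult.commute)
    also have "\<dots> \<le> ?S * max ?M1 ?M2" by (intro mult_left_mono) auto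
    finally show ?thesis .
  qed
qed

lemma output_approximate_minimizer:
  assumes f: "cont_differentiable p f" and q: "1 \<le> q" "q \<le> p" and \<beta>: "0 < \<beta>" "\<beta> \<le> 1" and \<sigma>: "0 < \<sigma>"
    and \<epsilon>: "0 < \<epsilon>" and \<theta>: "0 < \<theta>" and F: "closed F" and x: "x \<in> F"
    and none: "\<nexists>s \<delta>. admissible_step f F p q \<beta> \<epsilon> \<omega> \<theta> x \<sigma> s \<delta>"
  obtains \<delta> where "0 < \<delta>" "\<delta> \<le> 1" "phi_fun f F q \<delta> x \<le> \<epsilon> * chi q \<delta>"
proof -
  have p: "1 \<le> p" using q by simp
  have "model f p \<beta> x \<sigma> 0 \<le> model f p \<beta> x \<sigma> s" if "x + s \<in> F" for s
  proof (rule ccontr)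
    assume "\<not> ?thesis"
    then have "model f p \<beta> x \<sigma> s < model f p \<beta> x \<sigma> 0" by simp
    from admissible_step_exists[OF f p q(1) \<beta>(1) \<sigma> \<theta> F that this] none show False by metis
  qed
  from phi_fun_small_of_model_minimal[OF f q \<beta> \<sigma> \<epsilon> x this] show ?thesis using that by blast
qed

lemma sigma_update_growth:
  assumes u: "sigma_update \<sigma>_min \<eta>1 \<eta>2 \<gamma>1 \<gamma>2 \<gamma>3 r \<sigma> \<sigma>'" and \<sigma>: "0 < \<sigma>" and \<gamma>: "\<gamma>1 < 1" and \<eta>: "\<eta>1 \<le> \<eta>2"
  shows "(if \<eta>1 \<le> r then \<gamma>1 else \<gamma>2) * \<sigma> \<le> \<sigma>'"
proof -
  have "\<gamma>1 * \<sigma> \<le> 1 * \<sigma>" using \<sigma> \<gamma> by (intro mult_right_mono) auto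
  then show ?thesis using u \<eta> unfolding sigma_update_def by (auto split: if_splits)
qed

text \<open>Every iteration multiplies the weight by at least \<open>\<gamma>1\<close> or, if unsuccessful, by at least \<open>\<gamma>2\<close>,
  so an upper bound on the weights limits the number of unsuccessful iterations.\<close>
lemma iterations_le_successful:
  fixes \<sigma> :: "nat \<Rightarrow> real"
  assumes \<gamma>: "0 < \<gamma>1" "\<gamma>1 < 1" "1 < \<gamma>2" and \<sigma>0: "0 < \<sigma> 0"
    and step: "\<And>k. k < K \<Longrightarrow> (if P k then \<gamma>1 else \<gamma>2) * \<sigma> k \<le> \<sigma> (Suc k)"
    and max: "\<sigma> K \<le> \<sigma>_max"
  shows "real K \<le> card {k. k < K \<and> P k} * (1 + \<bar>ln \<gamma>1\<bar> / ln \<gamma>2) + 1 / ln \<gamma>2 * ln (\<sigma>_max / \<sigma> 0)"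
proof -
  have prod: "J \<le> K \<Longrightarrow> (\<Prod>k<J. if P k then \<gamma>1 else \<gamma>2) * \<sigma> 0 \<le> \<sigma> J" for J
  proof (induction J)
    case 0
    then show ?case by simp
  next
    case (Suc J)
    have "(\<Prod>k<Suc J. if P k then \<gamma>1 else \<gamma>2) * \<sigma> 0 = (if P J then \<gamma>1 else \<gamma>2) * ((\<Prod>k<J. if P k then \<gamma>1 else \<gamma>2) * \<sigma> 0)"
      by (simp add: mult_ac)
    also have "\<dots> \<le> (if P J then \<gamma>1 else \<gamma>2) * \<sigma> J"
      using Suc \<gamma> by (intro mult_left_mono) auto
    also have "\<dots> \<le> \<sigma> (Suc J)" using Suc.prems by (intro step) simp
    finally show ?case .
  qed
  define S where "S = {k. k < K \<and> P k}"
  define U where "U = {k. k < K \<and> \<not> P k}"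
  have fin: "finite S" "finite U" unfolding S_def U_def by auto
  have SU: "{..<K} = S \<union> U" "S \<inter> U = {}" unfolding S_def U_def by auto
  have K: "real K = real (card S) + real (card U)"
    using card_Un_disjoint[OF fin SU(2)] arg_cong[OF SU(1), of card] by simp
  have "(\<Prod>k<K. if P k then \<gamma>1 else \<gamma>2) = (\<Prod>k\<in>S. if P k then \<gamma>1 else \<gamma>2) * (\<Prod>k\<in>U. if P k then \<gamma>1 else \<gamma>2)"
    unfolding SU(1) by (rule prod.union_disjoint[OF fin SU(2)])
  also have "(\<Prod>k\<in>S. if P k then \<gamma>1 else \<gamma>2) = (\<Prod>k\<in>S. \<gamma>1)" by (rule prod.cong) (auto simp: S_def)
  also have "(\<Prod>k\<in>U. if P k then \<gamma>1 else \<gamma>2) = (\<Prod>k\<in>U. \<gamma>2)" by (rule prod.cong) (auto simp: U_def)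
  finally have "\<gamma>1 ^ card S * \<gamma>2 ^ card U * \<sigma> 0 \<le> \<sigma>_max" using prod[of K] max by simp
  then have le: "\<gamma>1 ^ card S * \<gamma>2 ^ card U \<le> \<sigma>_max / \<sigma> 0" using \<sigma>0 by (simp add: le_divide_eq)
  have pos: "0 < \<gamma>1 ^ card S * \<gamma>2 ^ card U" using \<gamma> by simp
  have "ln (\<gamma>1 ^ card S * \<gamma>2 ^ card U) \<le> ln (\<sigma>_max / \<sigma> 0)"
    using le pos by (intro ln_mono) auto
  then have "card S * ln \<gamma>1 + card U * ln \<gamma>2 \<le> ln (\<sigma>_max / \<sigma> 0)"
    using \<gamma> by (simp add: ln_mult ln_realpow)
  moreover have "\<bar>ln \<gamma>1\<bar> = - ln \<gamma>1" using \<gamma> by simp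
  ultimately have "card U * ln \<gamma>2 \<le> card S * \<bar>ln \<gamma>1\<bar> + ln (\<sigma>_max / \<sigma> 0)" by simp
  then have "card U \<le> (card S * \<bar>ln \<gamma>1\<bar> + ln (\<sigma>_max / \<sigma> 0)) / ln \<gamma>2"
    using \<gamma> by (subst le_divide_eq) simp
  also have "\<dots> = card S * (\<bar>ln \<gamma>1\<bar> / ln \<gamma>2) + 1 / ln \<gamma>2 * ln (\<sigma>_max / \<sigma> 0)"
    by (simp add: add_divide_distrib)
  finally show ?thesis unfolding K S_def[symmetric] by (simp add: distrib_left)
qed

theorem theorem3p4:
  fixes f :: "real ^ 'n \<Rightarrow> real" and F :: "(real ^ 'n) set" and p q :: nat
    and \<beta> f_low L \<epsilon> \<omega> \<theta> \<delta>_init \<sigma>0 \<sigma>_min \<eta>1 \<eta>2 \<gamma>1 \<gamma>2 \<gamma>3 \<sigma>_max \<kappa>_p :: real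
    and x0 :: "real ^ 'n" and N :: enat
    and x s :: "nat \<Rightarrow> real ^ 'n" and \<sigma> \<delta> :: "nat \<Rightarrow> real"
  assumes "1 \<le> p" and "0 < \<beta>" and "\<beta> \<le> 1"
    and "holder_class p \<beta> f f_low L"
    and "closed F" and "F \<noteq> {}"
    and "1 \<le> q" and "q \<le> p"
    and "x0 \<in> F" and "0 < \<epsilon>" and "\<epsilon> < 1"
    and "0 < \<omega>" and "\<omega> \<le> 1" and "0 < \<theta>"
    and "0 < \<delta>_init" and "\<delta>_init \<le> 1"
    and "0 < \<sigma>0" and "0 < \<sigma>_min" and "\<sigma>_min \<le> \<sigma>0"
    and "0 < \<eta>1" and "\<eta>1 \<le> \<eta>2" and "\<eta>2 < 1"
    and "0 < \<gamma>1" and "\<gamma>1 < 1" and "1 < \<gamma>2" and "\<gamma>2 < \<gamma>3"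
    and "\<sigma>_max = max \<sigma>0 (\<gamma>3 * L / (1 - \<eta>2))"
    and "\<kappa>_p = gfact p \<beta> / (\<eta>1 * \<sigma>_min) *
           max (\<omega> powr (- (real p + \<beta>)))
               (((L + \<sigma>_max + \<theta>) / gfact (p - q) \<beta>)
                  powr ((real p + \<beta>) / (real (p - q) + \<beta>)))"
    and "ARp_execution f F p q \<beta> \<epsilon> \<omega> \<theta> \<delta>_init \<sigma>_min \<eta>1 \<eta>2 \<gamma>1 \<gamma>2 \<gamma>3 x0 \<sigma>0 N x \<sigma> s \<delta>"
  shows "\<exists>K. N = enat K \<and>
     int (card {k. k < K \<and> successful f p \<eta>1 x s k})
       \<le> \<lfloor>\<kappa>_p * (f x0 - f_low) * \<epsilon> powr (- ((real p + \<beta>) / (real (p - q) + \<beta>)))\<rfloor> + 1 \<and>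
     int K
       \<le> \<lfloor>real_of_int
             \<lfloor>\<kappa>_p * (f x0 - f_low) * \<epsilon> powr (- ((real p + \<beta>) / (real (p - q) + \<beta>))) + 1\<rfloor>
            * (1 + \<bar>ln \<gamma>1\<bar> / ln \<gamma>2) + 1 / ln \<gamma>2 * ln (\<sigma>_max / \<sigma>0)\<rfloor> \<and>
     x K \<in> F \<and> (\<exists>\<delta>'. 0 < \<delta>' \<and> \<delta>' \<le> 1 \<and> phi_fun f F q \<delta>' (x K) \<le> \<epsilon> * chi q \<delta>')"
proof -
  note \<beta> = assms(2,3) and f = assms(4) and F = assms(5) and q = assms(7,8) and x0 = assms(9)
    and \<epsilon> = assms(10,11) and \<omega> = assms(12,13) and \<theta> = assms(14) and \<delta>_init = assms(15,16)
    and \<sigma>0 = assms(17) and \<sigma>_min = assms(18,19) and \<eta> = assms(20-22) and \<gamma> = assms(23-26)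
    and \<sigma>_max = assms(27) and \<kappa>_p = assms(28)
  have cd: "cont_differentiable p f" and low: "\<And>y. f_low \<le> f y"
    using f unfolding holder_class_def by blast+
  have init: "x 0 = x0" "\<sigma> 0 = \<sigma>0"
    and nstop: "\<And>k. enat k < N \<Longrightarrow> \<not> stops_in_step1 f F p q \<epsilon> \<delta>_init \<eta>1 x s \<delta> k"
    and adm: "\<And>k. enat k < N \<Longrightarrow> admissible_step f F p q \<beta> \<epsilon> \<omega> \<theta> (x k) (\<sigma> k) (s k) (\<delta> k)"
    and nxt: "\<And>k. enat k < N \<Longrightarrow> x (Suc k) = (if successful f p \<eta>1 x s k then x k + s k else x k)"
    and upd: "\<And>k. enat k < N \<Longrightarrow> sigma_update \<sigma>_min \<eta>1 \<eta>2 \<gamma>1 \<gamma>2 \<gamma>3 (rho f p (x k) (s k)) (\<sigma> k) (\<sigma> (Suc k))"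
    and fin: "\<And>K. N = enat K \<Longrightarrow> stops_in_step1 f F p q \<epsilon> \<delta>_init \<eta>1 x s \<delta> K \<or>
        (\<nexists>s' \<delta>'. admissible_step f F p q \<beta> \<epsilon> \<omega> \<theta> (x K) (\<sigma> K) s' \<delta>')"
    using assms(29) unfolding ARp_execution_def by blast+
  have Suc_le: "enat k < N" if "enat (Suc k) \<le> N" for k
    using that by (simp add: Suc_ile_eq)
  have le: "enat k \<le> N" if "enat (Suc k) \<le> N" for k
    using Suc_le[OF that] by simp

  have xF: "x k \<in> F" if "enat k \<le> N" for k
    using that
  proof (induction k)
    case 0
    then show ?case using init x0 by simp
  next
    case (Suc k)
    then show ?case using nxt[OF Suc_le] adm[OF Suc_le] le unfolding admissible_step_def by simp
  qed
  \<comment> \<open>A weight of at least L / (1 - \<eta>2) makes \<rho> \<ge> \<eta>2 and is not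
    raised; a smaller one is multiplied by at most \<gamma>3. This is the origin of
    \<sigma>_max.\<close>
  have sig: "\<sigma>_min \<le> \<sigma> k \<and> \<sigma> k \<le> \<sigma>_max" if "enat k \<le> N" for k
    using that
  proof (induction k)
    case 0
    then show ?case using init \<sigma>_min \<sigma>_max by simp
  next
    case (Suc k)
    note k = Suc_le[OF Suc.prems]
    have IH: "\<sigma>_min \<le> \<sigma> k" "\<sigma> k \<le> \<sigma>_max" using Suc le by auto
    then have pos: "0 < \<sigma> k" using \<sigma>_min by simp
    have "\<gamma>2 * \<sigma> k \<le> \<gamma>3 * \<sigma> k" "1 * \<sigma> k \<le> \<gamma>2 * \<sigma> k"
      using \<gamma> pos by (intro mult_right_mono; simp)+
    then have range: "\<sigma>_min \<le> \<sigma> (Suc k)" "\<sigma> (Suc k) \<le> \<gamma>3 * \<sigma> k"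
      "\<eta>2 \<le> rho f p (x k) (s k) \<Longrightarrow> \<sigma> (Suc k) \<le> \<sigma> k"
      using upd[OF k] IH unfolding sigma_update_def by (auto split: if_splits)
    have "\<sigma> (Suc k) \<le> \<sigma>_max"
    proof (cases "L / (1 - \<eta>2) \<le> \<sigma> k")
      case True
      from rho_ge_of_large_weight[OF f \<beta>(1) \<eta>(3) adm[OF k] pos this] range(3) IH show ?thesis by simp
    next
      case False
      then have "\<gamma>3 * \<sigma> k \<le> \<gamma>3 * (L / (1 - \<eta>2))" using \<gamma> by (intro mult_left_mono) auto
      also have "\<dots> \<le> \<sigma>_max" by (simp add: \<sigma>_max)
      finally show ?thesis using range(2) by simp
    qed
    with range show ?case by simp
  qed
  have pos: "0 < \<sigma> k" if "enat k \<le> N" for k using sig[OF that] \<sigma>_min by simp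

  define a b where "a = real (p - q) + \<beta>" and "b = real p + \<beta>"
  define M where "M = max (\<omega> powr (- b)) (((L + \<sigma>_max + \<theta>) / gfact (p - q) \<beta>) powr (b / a))"
  \<comment> \<open>Its inverse is the guaranteed decrease of \<open>f\<close> in a successful step
    that is not the last.\<close>
  define A where "A = \<kappa>_p * \<epsilon> powr (- (b / a))"
  have g: "0 < gfact p \<beta>" using gfact_pos[OF \<beta>(1)] .
  have M: "0 < M" unfolding M_def using \<omega> by (simp add: less_max_iff_disj)
  have kM: "\<kappa>_p = gfact p \<beta> / (\<eta>1 * \<sigma>_min) * M" unfolding \<kappa>_p M_def a_def b_def ..
  have A: "0 < A" unfolding A_def kM using g \<eta> \<sigma>_min M \<epsilon> by simp

  have dec: "\<eta>1 * (\<sigma>_min / gfact p \<beta> * norm (s k) powr b) \<le> f (x k) - f (x (Suc k))"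
    if k: "enat k < N" and su: "successful f p \<eta>1 x s k" for k
  proof -
    define T where "T = taylor f p (x k) 0 - taylor f p (x k) (s k)"
    have gt: "\<sigma> k / gfact p \<beta> * norm (s k) powr b < T"
      unfolding T_def b_def by (rule admissible_step_decrease(2)[OF cd \<beta>(1) adm[OF k]])
    have "\<sigma>_min / gfact p \<beta> * norm (s k) powr b \<le> \<sigma> k / gfact p \<beta> * norm (s k) powr b"
      using sig[of k] k g by (intro mult_right_mono divide_right_mono) auto
    with gt have T: "\<sigma>_min / gfact p \<beta> * norm (s k) powr b \<le> T" by simp
    have "0 < \<sigma> k" using pos k by simp
    then have "0 \<le> \<sigma> k / gfact p \<beta> * norm (s k) powr b" using g by simp
    with gt have T0: "0 < T" by simp
    have "\<eta>1 * T \<le> f (x k) - f (x k + s k)"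
      using su T0 unfolding successful_def rho_def T_def[symmetric] by (simp add: le_divide_eq)
    moreover have "\<eta>1 * (\<sigma>_min / gfact p \<beta> * norm (s k) powr b) \<le> \<eta>1 * T"
      using T \<eta> by (intro mult_left_mono) auto
    ultimately show ?thesis using nxt[OF k] su by simp
  qed
  \<comment> \<open>Iteration \<open>Suc k\<close> takes place, so the stopping test at
    \<open>x (Suc k)\<close> with radius \<open>\<delta> k\<close> has failed. Nothing of the kind
    is known after the last iteration, which accounts for the summand 1 in the bound.\<close>
  have dec_A: "1 / A \<le> f (x k) - f (x (Suc k))"
    if k: "enat (Suc k) < N" and su: "successful f p \<eta>1 x s k" for k
  proof -
    have k': "enat k < N" using k by (metis Suc_le less_imp_le)
    have "\<not> stop_test f F q \<epsilon> (x k + s k) (\<delta> k)"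
      using nstop[OF k] su nxt[OF k'] by (simp add: stops_in_step1_def)
    from step_lower_bound[OF f \<beta>(1) q \<epsilon> \<omega> \<theta> adm[OF k'] _ _ this, of \<sigma>_max] sig[of k] pos[of k] k'
    have "\<epsilon> powr (b / a) \<le> norm (s k) powr b * M"
      by (simp add: M_def a_def b_def)
    then have "\<epsilon> powr (b / a) / M \<le> norm (s k) powr b" using M by (simp add: divide_le_eq)
    then have "\<eta>1 * (\<sigma>_min / gfact p \<beta> * (\<epsilon> powr (b / a) / M)) \<le> \<eta>1 * (\<sigma>_min / gfact p \<beta> * norm (s k) powr b)"
      using \<eta> \<sigma>_min g by (intro mult_left_mono) auto
    also have "\<dots> \<le> f (x k) - f (x (Suc k))" by (rule dec[OF k' su])
    also have "\<eta>1 * (\<sigma>_min / gfact p \<beta> * (\<epsilon> powr (b / a) / M)) = 1 / A"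
      unfolding A_def kM powr_minus by (simp add: divide_simps)
    finally show ?thesis .
  qed
  have decreasing: "f (x (Suc k)) \<le> f (x k)" if k: "enat k < N" for k
  proof (cases "successful f p \<eta>1 x s k")
    case True
    have "0 \<le> \<eta>1 * (\<sigma>_min / gfact p \<beta> * norm (s k) powr b)" using \<eta> \<sigma>_min g by simp
    with dec[OF k True] show ?thesis by simp
  qed (simp add: nxt[OF k])

  let ?S = "\<lambda>K. {k. k < K \<and> successful f p \<eta>1 x s k}"
  have S_Suc: "card (?S (Suc J)) = card (?S J) + (if successful f p \<eta>1 x s J then 1 else 0)" for J
  proof -
    have "?S (Suc J) = (if successful f p \<eta>1 x s J then insert J (?S J) else ?S J)"
      by (auto simp: less_Suc_eq)
    then show ?thesis by simp
  qed
  have sum: "f (x J) + card (?S J) / A \<le> f x0" if "enat J < N" for J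
    using that
  proof (induction J)
    case 0
    then show ?case by (simp add: init)
  next
    case (Suc J)
    have J: "enat J < N" using Suc.prems by (metis Suc_le less_imp_le)
    show ?case
    proof (cases "successful f p \<eta>1 x s J")
      case True
      then show ?thesis
        using Suc.IH[OF J] dec_A[OF Suc.prems True] by (simp add: S_Suc add_divide_distrib)
    next
      case False
      then show ?thesis using Suc.IH[OF J] decreasing[OF J] by (simp add: S_Suc)
    qed
  qed
  have A0: "0 \<le> A * (f x0 - f_low)" using A low[of x0] by simp
  have succ: "int (card (?S K)) \<le> \<lfloor>A * (f x0 - f_low)\<rfloor> + 1" if K: "enat K \<le> N" for K
  proof (cases K)
    case 0
    then show ?thesis using A0 by simp
  next
    case (Suc J)
    have "card (?S J) / A \<le> f x0 - f_low"
      using sum[of J] low[of "x J"] Suc_le[of J] K Suc by simp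
    then have "real (card (?S J)) \<le> A * (f x0 - f_low)" using A by (simp add: divide_le_eq mult.commute)
    then have "int (card (?S J)) \<le> \<lfloor>A * (f x0 - f_low)\<rfloor>" by (simp add: le_floor_iff)
    then show ?thesis unfolding Suc S_Suc by simp
  qed
  define B where "B = real_of_int \<lfloor>A * (f x0 - f_low) + 1\<rfloor> * (1 + \<bar>ln \<gamma>1\<bar> / ln \<gamma>2) + 1 / ln \<gamma>2 * ln (\<sigma>_max / \<sigma>0)"
  \<comment> \<open>\<open>B\<close> does not depend on \<open>K\<close>, so for infinite
    \<open>N\<close> an index beyond \<open>B\<close> gives a contradiction.\<close>
  have total: "int K \<le> \<lfloor>B\<rfloor>" if K: "enat K \<le> N" for K
  proof -
    have lt: "enat k < N" if "k < K" for k using that K by (metis enat_ord_simps(2) less_le_trans)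
    have "real K \<le> card (?S K) * (1 + \<bar>ln \<gamma>1\<bar> / ln \<gamma>2) + 1 / ln \<gamma>2 * ln (\<sigma>_max / \<sigma> 0)"
    proof (rule iterations_le_successful[OF \<gamma>(1-3)])
      fix k assume "k < K"
      from sigma_update_growth[OF upd[OF lt[OF this]] pos \<gamma>(2) \<eta>(2)] lt[OF this]
      show "(if successful f p \<eta>1 x s k then \<gamma>1 else \<gamma>2) * \<sigma> k \<le> \<sigma> (Suc k)"
        by (simp add: successful_def)
    qed (use init \<sigma>0 sig[OF K] in auto)
    also have "real (card (?S K)) \<le> real_of_int \<lfloor>A * (f x0 - f_low) + 1\<rfloor>"
      using succ[OF K] by simp
    then have "card (?S K) * (1 + \<bar>ln \<gamma>1\<bar> / ln \<gamma>2) + 1 / ln \<gamma>2 * ln (\<sigma>_max / \<sigma> 0) \<le> B"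
      unfolding B_def init(2) using \<gamma> by (intro add_right_mono mult_right_mono) auto
    finally show ?thesis by (simp add: le_floor_iff)
  qed
  obtain K where N: "N = enat K"
  proof (cases N)
    case infinity
    then show ?thesis using total[of "nat (\<bar>\<lfloor>B\<rfloor>\<bar> + 1)"] by simp
  qed (use that in blast)
  have K: "enat K \<le> N" by (simp add: N)
  have "\<exists>\<delta>'. 0 < \<delta>' \<and> \<delta>' \<le> 1 \<and> phi_fun f F q \<delta>' (x K) \<le> \<epsilon> * chi q \<delta>'"
    using fin[OF N]
  proof
    assume stop: "stops_in_step1 f F p q \<epsilon> \<delta>_init \<eta>1 x s \<delta> K"
    show ?thesis
    proof (cases K)
      case 0
      then show ?thesis
        using stop \<delta>_init unfolding stops_in_step1_def stop_test_def by (intro exI[of _ \<delta>_init]) simp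
    next
      case (Suc J)
      have "0 < \<delta> J" "\<delta> J \<le> 1" using adm[of J] unfolding N Suc admissible_step_def by auto
      then show ?thesis
        using stop Suc unfolding stops_in_step1_def stop_test_def by (intro exI[of _ "\<delta> J"]) simp
    qed
  next
    assume "\<nexists>s' \<delta>'. admissible_step f F p q \<beta> \<epsilon> \<omega> \<theta> (x K) (\<sigma> K) s' \<delta>'"
    from output_approximate_minimizer[OF cd q \<beta> pos[OF K] \<epsilon>(1) \<theta> F xF[OF K] this] show ?thesis by blast
  qed
  note approx = this
  have eq: "\<kappa>_p * (f x0 - f_low) * \<epsilon> powr (- ((real p + \<beta>) / (real (p - q) + \<beta>))) = A * (f x0 - f_low)"
    by (simp add: A_def a_def b_def)
  show ?thesis
    unfolding eq using N succ[OF K] total[OF K, unfolded B_def] xF[OF K] approx by blast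
qed

end
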